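(* Let $u\in\mathcal{L}PSH^*(\mathbb{C}^n)$ be toric with $c_\infty(u)<1$. Then $\mathcal{P}_\infty(u)=\mathcal{P}_\infty(\Psi_u)$, and this vector space is generated (as a $\mathbb{C}$-vector space) by the monomials $z^J$, $J\in\mathbb{Z}_{\ge0}^n$, such that $J+\mathbf 1$ belongs to the interior of $\Gamma_{u,\infty}$.
   Context: $\mathcal{L}PSH(\mathbb{C}^n)$: plurisubharmonic $u$ on $\mathbb{C}^n$ with $\limsup_{|z|\to\infty}u(z)/\log|z|<\infty$; $\mathcal{L}PSH^*(\mathbb{C}^n)$: those with $u(z)\to+\infty$ as $|z|\to\infty$. Toric: $u(z)=u(|z_1|,\ldots,|z_n|)$. $g\in L^2(\infty)$ means $\int_{\mathbb{C}^n\setminus K}|g|^2d\lambda<\infty$ for some compact $K$; $c_\infty(u)=\inf\{c>0:e^{-cu}\in L^2(\infty)\}$. $\mathcal{P}_\infty(u)$ is the set of polynomials $P:\mathbb{C}^n\to\mathbb{C}$ with $|P|e^{-u}\in L^2(\infty)$. The logarithmic indicator is $\Psi_u(z)=\lim_{R\to\infty}R^{-1}\sup\{u(\zeta):|\zeta_k|\le|z_k|^R,\ 1\le k\le n\}$ for $z_1\cdots z_n\neq0$, extended by continuity; $\psi_u(t)=\Psi_u(e^{t_1},\ldots,e^{t_n})$; $\Gamma_{u,\infty}=\{a\in\mathbb{R}^n:\langle a,t\rangle\le\max\{\psi_u(t),0\}\ \forall t\in\mathbb{R}^n\}$; $\mathbf 1=(1,\ldots,1)$. *)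

theory Defs
  imports "HOL-Analysis.Analysis"
begin

definition usc :: "('a::topological_space \<Rightarrow> ereal) \<Rightarrow> bool" where
  "usc u \<longleftrightarrow> (\<forall>c. open {z. u z < c})"

text \<open>Mean value of u over the circle a + r e^{i theta} b, theta in [0, 2 pi]
  (integral of the positive part minus integral of the negative part).\<close>
definition circle_mean :: "(complex^'n \<Rightarrow> ereal) \<Rightarrow> complex^'n \<Rightarrow> complex^'n \<Rightarrow> real \<Rightarrow> ereal" where
  "circle_mean u a b r =
     (enn2ereal (\<integral>\<^sup>+ \<theta>\<in>{0..2*pi}. e2ennreal (u (a + (of_real r * exp (\<i> * of_real \<theta>)) *s b)) \<partial>lborel)
      - enn2ereal (\<integral>\<^sup>+ \<theta>\<in>{0..2*pi}. e2ennreal (- u (a + (of_real r * exp (\<i> * of_real \<theta>)) *s b)) \<partial>lborel))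
     / ereal (2*pi)"

definition psh :: "(complex^'n \<Rightarrow> ereal) \<Rightarrow> bool" where
  "psh u \<longleftrightarrow> usc u \<and> (\<forall>z. u z < \<infinity>) \<and> (\<exists>z. u z \<noteq> -\<infinity>) \<and>
     (\<forall>a b r. r > 0 \<longrightarrow> u a \<le> circle_mean u a b r)"

definition LPSH :: "(complex^'n \<Rightarrow> ereal) \<Rightarrow> bool" where
  "LPSH u \<longleftrightarrow> psh u \<and> Limsup at_infinity (\<lambda>z. u z / ereal (ln (norm z))) < \<infinity>"

definition LPSH_star :: "(complex^'n \<Rightarrow> ereal) \<Rightarrow> bool" where
  "LPSH_star u \<longleftrightarrow> LPSH u \<and> (u \<longlongrightarrow> \<infinity>) at_infinity"

definition toric :: "(complex^'n \<Rightarrow> ereal) \<Rightarrow> bool" where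
  "toric u \<longleftrightarrow> (\<forall>z w. (\<forall>k. norm (z$k) = norm (w$k)) \<longrightarrow> u z = u w)"

fun eexp :: "ereal \<Rightarrow> ennreal" where
  "eexp (ereal x) = ennreal (exp x)"
| "eexp PInfty = \<infinity>"
| "eexp MInfty = 0"

text \<open>g in L^2(infinity): square integrable outside some compact set (g given by |g|).\<close>
definition L2_inf :: "(complex^'n \<Rightarrow> ennreal) \<Rightarrow> bool" where
  "L2_inf g \<longleftrightarrow> (\<exists>K. compact K \<and> (\<integral>\<^sup>+ z\<in>UNIV - K. (g z)\<^sup>2 \<partial>lborel) < \<infinity>)"

definition c_inf :: "(complex^'n \<Rightarrow> ereal) \<Rightarrow> ereal" where
  "c_inf u = Inf {ereal c | c. c > 0 \<and> L2_inf (\<lambda>z. eexp (- (ereal c * u z)))}"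

definition monom :: "nat^'n \<Rightarrow> complex^'n \<Rightarrow> complex" where
  "monom J z = (\<Prod>k\<in>UNIV. (z$k) ^ (J$k))"

definition monom_span :: "(nat^'n) set \<Rightarrow> (complex^'n \<Rightarrow> complex) set" where
  "monom_span S = {P. \<exists>F c. finite F \<and> F \<subseteq> S \<and> P = (\<lambda>z. \<Sum>J\<in>F. c J * monom J z)}"

definition polys :: "(complex^'n \<Rightarrow> complex) set" where
  "polys = monom_span UNIV"

definition P_inf :: "(complex^'n \<Rightarrow> ereal) \<Rightarrow> (complex^'n \<Rightarrow> complex) set" where
  "P_inf u = {P \<in> polys. L2_inf (\<lambda>z. ennreal (cmod (P z)) * eexp (- u z))}"

definition Psi0 :: "(complex^'n \<Rightarrow> ereal) \<Rightarrow> complex^'n \<Rightarrow> ereal" where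
  "Psi0 u z = Lim at_top (\<lambda>R::real.
      Sup {u \<zeta> | \<zeta>. \<forall>k. norm (\<zeta>$k) \<le> norm (z$k) powr R} / ereal R)"

definition Psi :: "(complex^'n \<Rightarrow> ereal) \<Rightarrow> complex^'n \<Rightarrow> ereal" where
  "Psi u z = (if (\<forall>k. z$k \<noteq> 0) then Psi0 u z
              else Limsup (at z within {w. \<forall>k. w$k \<noteq> 0}) (Psi0 u))"

definition psi :: "(complex^'n \<Rightarrow> ereal) \<Rightarrow> real^'n \<Rightarrow> ereal" where
  "psi u t = Psi u (\<chi> k. complex_of_real (exp (t$k)))"

definition Gamma_inf :: "(complex^'n \<Rightarrow> ereal) \<Rightarrow> (real^'n) set" where
  "Gamma_inf u = {a. \<forall>t. ereal (a \<bullet> t) \<le> max (psi u t) 0}"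

end

theory Submission
  imports Defs "HOL-Complex_Analysis.Cauchy_Integral_Formula"
begin

text \<open>
  In logarithmic coordinates a toric plurisubharmonic function becomes a convex function \<open>\<phi>\<close>, and
  its indicator becomes the recession function \<open>\<psi>\<close> of \<open>\<phi>\<close>.  The two satisfy
  \<open>\<phi> (t + s) \<le> \<phi> t + \<psi> s\<close> and \<open>\<phi> t \<ge> \<psi> t - \<epsilon> |t| - C\<^sub>\<epsilon>\<close>, and so does the pair \<open>(\<psi>, \<psi>)\<close>; these bounds
  alone decide integrability at infinity.  The space of square integrable polynomials is invariant
  under the dilations \<open>z\<^sub>k \<mapsto> 2 z\<^sub>k\<close>, hence spanned by monomials.  The integral of \<open>|z\<^sup>J|\<^sup>2 exp (-2u)\<close> is
  that of \<open>exp (2 (\<langle>J + 1, t\<rangle> - \<phi> t))\<close> over the part of logarithmic space where some coordinate is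
  large; it is finite iff \<open>\<langle>J + 1, t\<rangle> < max (\<psi> t) 0\<close> for all \<open>t \<noteq> 0\<close>, which describes the interior of
  the convex body with support function \<open>max \<psi> 0\<close>.
\<close>

text \<open>The function \<open>u\<close> is only upper semicontinuous and may take the value
  -infinity, so convexity cannot be read off from derivatives, and the submean property is given on
  affine circles, which are not segments in logarithmic coordinates. This forces a comparison
  argument for \<open>ereal\<close>-valued functions; finiteness on the torus comes out only
  afterwards, from convexity and the growth of \<open>u\<close> to infinity. The same growth makes
  \<psi> nonnegative wherever some coordinate is positive; there \<open>max (\<psi> t) 0\<close> is
  \<open>\<psi> t\<close>, and this is the region that the tails see. In the remaining nonzero
  directions \<open>J + 1\<close>, having positive entries, satisfies the strict inequality by
  itself. The shift by 1 reflects the Jacobian of the logarithmic coordinates, but no change to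
  polar coordinates is carried out: convergence follows from a majorant that is a product over real
  and imaginary parts, divergence from explicit boxes. Dilations replace the usual averaging over
  the torus, so that isolating a monomial is finite linear algebra. The coordinate hyperplanes are
  null sets, so for integrability only values on the torus count.\<close>

section \<open>Convexity from the submean property\<close>

text \<open>Cauchy's formula at the centre: \<open>Ln (1 + \<rho> w)\<close> is holomorphic on the
  unit disc, because \<open>1 + \<rho> w\<close> has positive real part, and it vanishes at 0.
  Taking real parts gives the claim.\<close>

lemma integral_ln_norm_one_plus_circle:
  fixes \<rho> :: real
  assumes "\<bar>\<rho>\<bar> < 1"
  shows "((\<lambda>\<theta>. ln (cmod (1 + of_real \<rho> * exp (\<i> * of_real \<theta>)))) has_integral 0) {0..2*pi}"
proof -
  let ?f = "\<lambda>w. Ln (1 + of_real \<rho> * w)"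
  have nonpos: "1 + of_real \<rho> * w \<notin> \<real>\<^sub>\<le>\<^sub>0" if "w \<in> cball 0 1" for w :: complex
  proof -
    have "\<bar>\<rho> * Re w\<bar> \<le> \<bar>\<rho>\<bar> * 1"
      unfolding abs_mult using that abs_Re_le_cmod[of w] by (intro mult_left_mono) auto
    then show ?thesis using assms by (auto simp: complex_nonpos_Reals_iff)
  qed
  have "((\<lambda>w. ?f w / (w - 0)) has_contour_integral (2 * of_real pi * \<i> * ?f 0)) (circlepath 0 1)"
    by (intro Cauchy_integral_circlepath continuous_intros holomorphic_intros) (use nonpos in auto)
  then have "((\<lambda>\<theta>. Ln (1 + of_real \<rho> * cis \<theta>) / cis \<theta> * 1 * \<i> * cis \<theta>) has_integral 0) {0..2*pi}"
    unfolding circlepath_def by (subst (asm) has_contour_integral_part_circlepath_iff) auto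
  then have "((\<lambda>\<theta>. -\<i> * (\<i> * Ln (1 + of_real \<rho> * cis \<theta>))) has_integral (-\<i> * 0)) {0..2*pi}"
    by (intro has_integral_mult_right) (simp add: field_simps)
  then have "((\<lambda>\<theta>. Ln (1 + of_real \<rho> * cis \<theta>)) has_integral 0) {0..2*pi}"
    by simp
  then have "((\<lambda>\<theta>. Re (Ln (1 + of_real \<rho> * cis \<theta>))) has_integral Re 0) {0..2*pi}"
    by (rule has_integral_Re)
  moreover have "1 + of_real \<rho> * cis \<theta> \<noteq> 0" for \<theta>
    using nonpos[of "cis \<theta>"] by auto
  ultimately show ?thesis by (simp add: cis_conv_exp)
qed

text \<open>Quadratic remainder of \<open>Ln\<close> at 1. It makes a small circle look like the
  oscillation \<open>r cos \<theta>\<close> along \<open>d\<close> in logarithmic coordinates, up to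
  order r squared.\<close>

lemma ln_norm_one_plus_bound:
  fixes w :: complex
  assumes "cmod w \<le> 1/2"
  shows "\<bar>ln (cmod (1 + w)) - Re w\<bar> \<le> 2 * (cmod w)\<^sup>2"
proof -
  have "w \<noteq> -1" using assms by auto
  then have "1 + w \<noteq> 0" by (metis add.inverse_unique)
  then have "\<bar>ln (cmod (1 + w)) - Re w\<bar> = \<bar>Re (Ln (1 + w) - w)\<bar>" by simp
  also have "\<dots> \<le> cmod (Ln (1 + w) - w)" by (rule abs_Re_le_cmod)
  also have "\<dots> \<le> (cmod w)\<^sup>2 / (1 - cmod w)" using assms by (intro Ln_approx_linear) auto
  also have "\<dots> \<le> (cmod w)\<^sup>2 / (1/2)" using assms by (intro divide_left_mono) auto
  finally show ?thesis by simp
qed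

text \<open>\<open>circle_mean\<close> is a difference of two integrals with values in
  [0, infinity]. The majorant bounds the positive part from above and the negative part from below,
  and its own two integrals are finite, so the difference of the bounds is an ordinary real
  number.\<close>

lemma circle_mean_le:
  fixes u :: "complex^'n \<Rightarrow> ereal"
  assumes G: "continuous_on {0..2*pi} G"
    and le: "\<And>\<theta>. \<theta> \<in> {0..2*pi} \<Longrightarrow> u (a + (of_real r * exp (\<i> * of_real \<theta>)) *s b) \<le> ereal (G \<theta>)"
  shows "circle_mean u a b r \<le> ereal (integral {0..2*pi} G / (2*pi))"
proof -
  let ?I = "{0..2*pi}"
  let ?P = "integral ?I (\<lambda>\<theta>. max 0 (G \<theta>))" and ?N = "integral ?I (\<lambda>\<theta>. max 0 (- G \<theta>))"
  have intP: "(\<lambda>\<theta>. max 0 (G \<theta>)) integrable_on ?I" and intN: "(\<lambda>\<theta>. max 0 (- G \<theta>)) integrable_on ?I"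
    by (intro integrable_continuous_interval continuous_intros G)+
  have e: "e2ennreal (ereal x) = ennreal (max 0 x)" for x
    by (simp add: e2ennreal_ereal max_def ennreal_neg)
  have eP: "e2ennreal x \<le> ennreal (max 0 y)" if "x \<le> ereal y" for x y
    using e2ennreal_mono[OF that] by (simp only: e)
  have eN: "ennreal (max 0 (- y)) \<le> e2ennreal (- x)" if "x \<le> ereal y" for x y
    using that e2ennreal_mono[of "ereal (- y)" "- x"] by (simp only: e) (simp flip: uminus_ereal.simps)
  have "(\<integral>\<^sup>+ \<theta>\<in>?I. e2ennreal (u (a + (of_real r * exp (\<i> * of_real \<theta>)) *s b)) \<partial>lborel)
      \<le> (\<integral>\<^sup>+ \<theta>\<in>?I. ennreal (max 0 (G \<theta>)) \<partial>lborel)"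
    using le by (intro nn_integral_mono) (simp add: indicator_def eP del: ennreal_max_0)
  also have "\<dots> = ennreal ?P"
    using intP by (intro nn_integral_has_integral_lebesgue') auto
  finally have 1: "enn2ereal (\<integral>\<^sup>+ \<theta>\<in>?I. e2ennreal (u (a + (of_real r * exp (\<i> * of_real \<theta>)) *s b)) \<partial>lborel) \<le> ereal ?P"
    using integral_nonneg[OF intP] by (simp add: less_eq_ennreal.rep_eq)
  have "ennreal ?N = (\<integral>\<^sup>+ \<theta>\<in>?I. ennreal (max 0 (- G \<theta>)) \<partial>lborel)"
    using intN by (intro nn_integral_has_integral_lebesgue'[symmetric]) auto
  also have "\<dots> \<le> (\<integral>\<^sup>+ \<theta>\<in>?I. e2ennreal (- u (a + (of_real r * exp (\<i> * of_real \<theta>)) *s b)) \<partial>lborel)"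
    using le by (intro nn_integral_mono) (simp add: indicator_def eN del: ennreal_max_0)
  finally have 2: "ereal ?N \<le> enn2ereal (\<integral>\<^sup>+ \<theta>\<in>?I. e2ennreal (- u (a + (of_real r * exp (\<i> * of_real \<theta>)) *s b)) \<partial>lborel)"
    using integral_nonneg[OF intN] by (simp add: less_eq_ennreal.rep_eq)
  have "?P - ?N = integral ?I (\<lambda>\<theta>. max 0 (G \<theta>) - max 0 (- G \<theta>))"
    using intP intN by (simp add: integral_diff)
  also have "\<dots> = integral ?I G" by (intro integral_cong) auto
  finally have 3: "?P - ?N = integral ?I G" .
  have "circle_mean u a b r \<le> (ereal ?P - ereal ?N) / ereal (2*pi)"
    unfolding circle_mean_def using 1 2 by (intro ereal_divide_right_mono ereal_minus_mono) auto
  then show ?thesis using 3 by (simp add: ereal_divide)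
qed

text \<open>Without a maximum the open sets \<open>{z. f z < f y}\<close> would cover
  \<open>D\<close>; the largest \<open>f y\<close> of a finite subcover is then attained at an
  uncovered point.\<close>

lemma usc_attains_max:
  fixes f :: "'a::topological_space \<Rightarrow> ereal"
  assumes "compact D" "D \<noteq> {}" and op: "\<And>c. open {z. f z < c}"
  shows "\<exists>x\<in>D. \<forall>y\<in>D. f y \<le> f x"
proof (rule ccontr)
  assume "\<not> ?thesis"
  then have "D \<subseteq> (\<Union>y\<in>D. {z. f z < f y})" by (auto simp: not_le)
  then obtain Y where Y: "Y \<subseteq> D" "finite Y" "D \<subseteq> (\<Union>y\<in>Y. {z. f z < f y})"
    using op by (meson \<open>compact D\<close> compactE_image)
  then have "Y \<noteq> {}" using \<open>D \<noteq> {}\<close> by auto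
  have "Max (f ` Y) \<in> f ` Y" using Y \<open>Y \<noteq> {}\<close> by (intro Max_in) auto
  then obtain y0 where y0: "y0 \<in> Y" "f y0 = Max (f ` Y)" by auto
  then obtain y where "y \<in> Y" "f y0 < f y" using Y by blast
  then show False using y0 Y by (metis Max_ge finite_imageI imageI not_le)
qed

text \<open>A real number \<open>r\<close> inserted between \<open>f z\<close> and
  \<open>c + q z\<close> splits the condition into one open condition on \<open>f\<close> and one on
  \<open>q\<close>.\<close>

lemma usc_diff_continuous:
  fixes f :: "'a::topological_space \<Rightarrow> ereal"
  assumes op: "\<And>c. open {z. f z < c}" and fin: "\<And>z. f z < \<infinity>" and q: "continuous_on UNIV q"
  shows "open {z. f z - ereal (q z) < c}"
proof (cases "c = \<infinity>")
  case True
  have "f z - ereal (q z) < \<infinity>" for z using fin[of z] by (cases "f z") auto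
  then have "{z. f z - ereal (q z) < c} = UNIV" using True by auto
  then show ?thesis by simp
next
  case False
  have "{z. f z - ereal (q z) < c} = (\<Union>r::real. {z. f z < ereal r} \<inter> {z. ereal (r - q z) < c})"
  proof (intro set_eqI iffI)
    fix z assume "z \<in> {z. f z - ereal (q z) < c}"
    then have "f z < c + ereal (q z)" by (cases "f z"; cases c) auto
    then obtain r where "f z < ereal r" "ereal r < c + ereal (q z)" using ereal_dense2 by blast
    then show "z \<in> (\<Union>r::real. {z. f z < ereal r} \<inter> {z. ereal (r - q z) < c})"
      by (cases c) auto
  next
    fix z assume "z \<in> (\<Union>r::real. {z. f z < ereal r} \<inter> {z. ereal (r - q z) < c})"
    then show "z \<in> {z. f z - ereal (q z) < c}" by (cases "f z"; cases c) auto
  qed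
  moreover have "open {z. ereal (r - q z) < c}" for r
    using q by (cases c) (auto intro!: open_Collect_less continuous_intros)
  ultimately show ?thesis using op by (simp add: open_UN open_Int)
qed

text \<open>Comparison argument: if convexity failed on a segment, then \<open>f - q\<close> would have an interior
  maximum on a thin cylinder around it, where \<open>q\<close> is strictly concave along the segment and steeply
  convex across it.  Linear functions of the logarithmic coordinates have mean zero over the
  displacement \<open>ln \<bar>1 + r d\<^sub>k exp (\<i> \<theta>)\<bar> = r d\<^sub>k cos \<theta> + O(r\<^sup>2)\<close>, so to order \<open>r\<^sup>2\<close> only the
  concavity along \<open>d\<close> survives, contradicting the submean inequality at the maximum.\<close>
lemma log_circle_submean_imp_convex:
  fixes f :: "real^'n \<Rightarrow> ereal" and p d :: "real^'n"
  assumes op: "\<And>c. open {t. f t < c}" and fin: "\<And>t. f t < \<infinity>"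
    and sub: "\<And>t r G. r > 0 \<Longrightarrow> (\<forall>k. \<bar>r * d$k\<bar> < 1) \<Longrightarrow> continuous_on {0..2*pi} G \<Longrightarrow>
       (\<And>\<theta>. f (t + (\<chi> k. ln (cmod (1 + of_real (r * d$k) * exp (\<i> * of_real \<theta>))))) \<le> ereal (G \<theta>)) \<Longrightarrow>
       f t \<le> ereal (integral {0..2*pi} G / (2*pi))"
    and fA: "f p \<le> ereal a" and fB: "f (p + d) \<le> ereal b" and x: "0 \<le> x" "x \<le> 1"
  shows "f (p + x *\<^sub>R d) \<le> ereal ((1-x) * a + x * b)"
proof (rule ccontr)
  assume contra: "\<not> ?thesis"
  define l where "l = (1-x) * a + x * b"
  obtain V where V: "f (p + x *\<^sub>R d) = ereal V"
    using contra fin[of "p + x *\<^sub>R d"] by (cases "f (p + x *\<^sub>R d)") auto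
  have Vl: "V > l" using contra V by (simp add: l_def)
  have "d \<noteq> 0"
  proof
    assume "d = 0"
    then have "V \<le> a" "V \<le> b" using fA fB V by auto
    then have "(1-x) * V + x * V \<le> l" unfolding l_def using x by (intro add_mono mult_left_mono) auto
    then show False using Vl by (simp add: algebra_simps)
  qed
  then have d0: "d \<bullet> d > 0" "norm d > 0" by auto
  \<comment> \<open>The concave bump \<open>\<epsilon> X (1 - X)\<close> added to the chord uses up
    only the fraction \<open>x (1 - x) < 1\<close> of the excess \<open>V - l\<close>; what remains
    is \<eta> > 0.\<close>
  define \<epsilon> where "\<epsilon> = V - l"
  have eps: "\<epsilon> > 0" using Vl by (simp add: \<epsilon>_def)
  define \<eta> where "\<eta> = V - l - \<epsilon> * (x * (1-x))"
  have "0 \<le> (x - 1/2)\<^sup>2" by simp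
  then have "x * (1-x) < 1" by (simp add: power2_eq_square algebra_simps)
  then have eta: "\<eta> > 0" unfolding \<eta>_def using mult_strict_left_mono[of "x*(1-x)" 1 \<epsilon>] eps by (simp add: \<epsilon>_def)
  \<comment> \<open>Coordinate along \<open>d\<close> and component orthogonal to
    \<open>d\<close>.\<close>
  define X where "X y = (y \<bullet> d) / (d \<bullet> d)" for y
  define Y where "Y y = y - X y *\<^sub>R d" for y
  have XY: "y = X y *\<^sub>R d + Y y" for y by (simp add: Y_def)
  have X_add: "X (y + z) = X y + X z" and X_scale: "X (c *\<^sub>R y) = c * X y" for y z c
    by (simp_all add: X_def inner_add_left add_divide_distrib)
  have Xd: "X d = 1" using d0 by (simp add: X_def)
  have Y_add: "Y (y + z) = Y y + Y z" and Y_scale: "Y (c *\<^sub>R y) = c *\<^sub>R Y y" for y z c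
    by (simp_all add: Y_def X_add X_scale algebra_simps)
  have Yd: "Y d = 0" by (simp add: Y_def Xd)
  have X_le: "\<bar>X y\<bar> \<le> norm y / norm d" for y
  proof -
    have "\<bar>X y\<bar> = \<bar>y \<bullet> d\<bar> / (norm d * norm d)" by (simp add: X_def dot_square_norm power2_eq_square)
    also have "\<dots> \<le> norm y * norm d / (norm d * norm d)"
      by (intro divide_right_mono Cauchy_Schwarz_ineq2) auto
    finally show ?thesis using d0 by simp
  qed
  have Y_le: "norm (Y y) \<le> 2 * norm y" for y
  proof -
    have "norm (Y y) \<le> norm y + \<bar>X y\<bar> * norm d"
      unfolding Y_def by (metis norm_scaleR norm_triangle_ineq4)
    also have "\<bar>X y\<bar> * norm d \<le> norm y" using X_le[of y] d0 by (simp add: field_simps)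
    finally show ?thesis by simp
  qed
  have contX: "continuous_on S (\<lambda>t. X (t - p))" and contY: "continuous_on S (\<lambda>t. Y (t - p))" for S
    unfolding Y_def X_def using d0 by (intro continuous_intros; simp)+
  define D where "D = {t. 0 \<le> X (t - p) \<and> X (t - p) \<le> 1 \<and> norm (Y (t - p)) \<le> 1}"
  have "closed D"
    unfolding D_def by (intro closed_Collect_conj closed_Collect_le continuous_intros contX contY)
  moreover have "D \<subseteq> cball p (norm d + 1)"
  proof
    fix t assume t: "t \<in> D"
    have "norm (t - p) \<le> \<bar>X (t - p)\<bar> * norm d + norm (Y (t - p))"
      by (metis XY norm_scaleR norm_triangle_ineq)
    also have "\<dots> \<le> 1 * norm d + 1" using t by (intro add_mono mult_right_mono) (auto simp: D_def)
    finally show "t \<in> cball p (norm d + 1)" by (simp add: dist_norm norm_minus_commute)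
  qed
  ultimately have "compact D"
    by (metis bounded_cball bounded_subset compact_eq_bounded_closed)
  have X0 [simp]: "X 0 = 0" and Y0 [simp]: "Y 0 = 0" by (simp_all add: X_def Y_def)
  have "p \<in> D" by (simp add: D_def)
  have xD: "p + x *\<^sub>R d \<in> D" using x by (simp add: D_def X_scale Y_scale Xd Yd)
  obtain m where "\<forall>y\<in>D. f y \<le> f m"
    using usc_attains_max[OF \<open>compact D\<close> _ op] \<open>p \<in> D\<close> by blast
  moreover obtain W where "f m \<le> ereal W" using fin[of m] by (cases "f m") auto
  ultimately have W: "f y \<le> ereal W" if "y \<in> D" for y using that order_trans by blast
  \<comment> \<open>Upper semicontinuity at the two ends: close to them \<open>f\<close> exceeds the
    chord by less than \<eta>, so the maximum of \<open>f - q\<close>, being at least \<eta>, cannot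
    lie on the end faces of the cylinder.\<close>
  have "p \<in> {t. f t < ereal (a + \<eta>)}" "p + d \<in> {t. f t < ereal (b + \<eta>)}"
    using fA fB eta by (auto intro: le_less_trans)
  then obtain \<delta>1 \<delta>2 where del: "\<delta>1 > 0" "ball p \<delta>1 \<subseteq> {t. f t < ereal (a + \<eta>)}"
      "\<delta>2 > 0" "ball (p + d) \<delta>2 \<subseteq> {t. f t < ereal (b + \<eta>)}"
    using op by (meson open_contains_ball_eq)
  define \<delta> where "\<delta> = min 1 (min \<delta>1 \<delta>2)"
  have delta: "\<delta> > 0" "\<delta> \<le> 1" using del by (auto simp: \<delta>_def)
  \<comment> \<open>Steep enough that \<open>q\<close> reaches the upper bound \<open>W\<close> of
    \<open>f\<close> once the distance from the axis is \<delta>, which keeps the maximum away from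
    the lateral face.\<close>
  define M where "M = max 0 ((W - min a b) / \<delta>\<^sup>2)"
  have M: "M \<ge> 0" "M * \<delta>\<^sup>2 \<ge> W - min a b"
    using delta by (auto simp: M_def max_def field_simps not_le)
  define q where "q t = a + (b - a) * X (t - p) + \<epsilon> * (X (t - p) * (1 - X (t - p))) + M * (norm (Y (t - p)))\<^sup>2" for t
  have q_ge: "q t \<ge> min a b + M * (norm (Y (t - p)))\<^sup>2" if "t \<in> D" for t
  proof -
    have "\<epsilon> * (X (t - p) * (1 - X (t - p))) \<ge> 0" using that eps by (auto simp: D_def)
    moreover have "a + (b - a) * X (t - p) = (1 - X (t - p)) * a + X (t - p) * b" by (simp add: algebra_simps)
    moreover have "(1 - X (t - p)) * a + X (t - p) * b \<ge> (1 - X (t - p)) * min a b + X (t - p) * min a b"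
      using that by (intro add_mono mult_left_mono) (auto simp: D_def)
    ultimately show ?thesis by (simp add: q_def algebra_simps)
  qed
  have "continuous_on UNIV q" unfolding q_def by (intro continuous_intros contX contY)
  then obtain t0 where t0: "t0 \<in> D" and t0max: "\<And>t. t \<in> D \<Longrightarrow> f t - ereal (q t) \<le> f t0 - ereal (q t0)"
    using usc_attains_max[OF \<open>compact D\<close> _ usc_diff_continuous[OF op fin]] \<open>p \<in> D\<close> by blast
  have "q (p + x *\<^sub>R d) = l + \<epsilon> * (x * (1 - x))"
    by (simp add: q_def X_scale Y_scale Xd Yd l_def algebra_simps)
  then have "f (p + x *\<^sub>R d) - ereal (q (p + x *\<^sub>R d)) = ereal \<eta>"
    by (simp add: V \<eta>_def)
  then have t0eta: "f t0 - ereal (q t0) \<ge> ereal \<eta>" using t0max[OF xD] by simp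
  then obtain F0 where F0: "f t0 = ereal F0" using fin[of t0] by (cases "f t0") auto
  have F0eta: "F0 - q t0 \<ge> \<eta>" using t0eta F0 by simp
  have Ysmall: "norm (Y (t0 - p)) < \<delta>"
  proof (rule ccontr)
    assume "\<not> ?thesis"
    then have "\<delta>\<^sup>2 \<le> (norm (Y (t0 - p)))\<^sup>2" using delta by (intro power_mono) auto
    then have "M * \<delta>\<^sup>2 \<le> M * (norm (Y (t0 - p)))\<^sup>2" using M by (intro mult_left_mono) auto
    then show False using q_ge[OF t0] W[OF t0] M F0 F0eta eta by auto
  qed
  have int0: "X (t0 - p) \<noteq> 0"
  proof
    assume *: "X (t0 - p) = 0"
    then have "t0 - p = Y (t0 - p)" by (simp add: Y_def)
    then have "t0 \<in> ball p \<delta>1" using Ysmall by (simp add: \<delta>_def dist_norm norm_minus_commute)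
    then have "F0 < a + \<eta>" using del F0 by auto
    moreover have "q t0 \<ge> a" using * M by (simp add: q_def)
    ultimately show False using F0eta by simp
  qed
  have int1: "X (t0 - p) \<noteq> 1"
  proof
    assume *: "X (t0 - p) = 1"
    then have "t0 - (p + d) = Y (t0 - p)" by (simp add: Y_def)
    then have "t0 \<in> ball (p + d) \<delta>2" using Ysmall by (simp add: \<delta>_def dist_norm norm_minus_commute)
    then have "F0 < b + \<eta>" using del F0 by auto
    moreover have "q t0 \<ge> b" using * M by (simp add: q_def)
    ultimately show False using F0eta by simp
  qed
  define x0 where "x0 = X (t0 - p)"
  have x0: "0 < x0" "x0 < 1" using int0 int1 t0 by (auto simp: x0_def D_def)
  have y0: "norm (Y (t0 - p)) < 1" using Ysmall delta by simp
  \<comment> \<open>\<open>C r\<^sup>2\<close> bounds the deviation of the displacement from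
    \<open>r cos \<theta> d\<close>: the logarithm bound in each coordinate, summed over the
    coordinates. \<open>K\<close> collects what this deviation contributes at order
    \<open>r ^ 4\<close> to the quadratic terms of \<open>q\<close> along and across
    \<open>d\<close>.\<close>
  define C where "C = 2 * (norm d)\<^sup>2 * real CARD('n)"
  define K where "K = \<epsilon> * C\<^sup>2 / (norm d)\<^sup>2 + 4 * M * C\<^sup>2"
  \<comment> \<open>In order: the logarithm bound applies, the displaced points stay in
    \<open>D\<close> lengthwise and crosswise, and the errors of order \<open>r ^ 4\<close> lose
    against the gain \<open>\<epsilon> r\<^sup>2 / 4\<close>.\<close>
  have ev: "\<forall>\<^sub>F r in at_right 0. r * norm d < 1/2 \<and> r + C * r\<^sup>2 / norm d < min x0 (1 - x0) \<and>
      2 * (C * r\<^sup>2) < 1 - norm (Y (t0 - p)) \<and> K * r\<^sup>2 < \<epsilon> / 4"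
  proof (intro eventually_conj)
    show "\<forall>\<^sub>F r in at_right 0. r * norm d < 1/2"
      by (rule order_tendstoD[where y = "0 * norm d"]) (auto intro!: tendsto_eq_intros)
    show "\<forall>\<^sub>F r in at_right 0. r + C * r\<^sup>2 / norm d < min x0 (1 - x0)"
      using x0 d0 by (intro order_tendstoD(2)[where y = "0 + C * 0\<^sup>2 / norm d"] tendsto_intros) auto
    show "\<forall>\<^sub>F r in at_right 0. 2 * (C * r\<^sup>2) < 1 - norm (Y (t0 - p))"
      using y0 by (intro order_tendstoD(2)[where y = "2 * (C * 0\<^sup>2)"] tendsto_intros) auto
    show "\<forall>\<^sub>F r in at_right 0. K * r\<^sup>2 < \<epsilon> / 4"
      using eps by (intro order_tendstoD(2)[where y = "K * 0\<^sup>2"] tendsto_intros) auto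
  qed
  have "\<forall>\<^sub>F r in at_right (0::real). r > 0" by (simp add: eventually_at_right_less)
  from eventually_happens'[OF _ eventually_conj[OF this ev]]
  obtain r where r: "r > 0" "r * norm d < 1/2" "r + C * r\<^sup>2 / norm d < min x0 (1 - x0)"
      "2 * (C * r\<^sup>2) < 1 - norm (Y (t0 - p))" "K * r\<^sup>2 < \<epsilon> / 4"
    by auto
  define H where "H \<theta> = (\<chi> k. ln (cmod (1 + of_real (r * d$k) * exp (\<i> * of_real \<theta>))))" for \<theta> :: real
  define e where "e \<theta> = H \<theta> - (r * cos \<theta>) *\<^sub>R d" for \<theta>
  have rd: "\<bar>r * d$k\<bar> < 1/2" for k
  proof -
    have "\<bar>r * d$k\<bar> \<le> r * norm d"
      unfolding abs_mult using r component_le_norm_cart[of d k] by (intro mult_mono) (auto simp: abs_mult)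
    then show ?thesis using r by simp
  qed
  have e_le: "norm (e \<theta>) \<le> C * r\<^sup>2" for \<theta>
  proof -
    have "\<bar>e \<theta> $ k\<bar> \<le> 2 * (norm d)\<^sup>2 * r\<^sup>2" for k
    proof -
      let ?w = "of_real (r * d$k) * exp (\<i> * of_real \<theta>)"
      have w: "cmod ?w = \<bar>r * d$k\<bar>" by (simp add: norm_mult abs_mult)
      have "Re ?w = r * cos \<theta> * d$k" by (simp add: Re_exp)
      then have "\<bar>e \<theta> $ k\<bar> = \<bar>ln (cmod (1 + ?w)) - Re ?w\<bar>"
        by (simp add: e_def H_def Re_exp mult.commute mult.left_commute)
      also have "\<dots> \<le> 2 * (cmod ?w)\<^sup>2"
        by (rule ln_norm_one_plus_bound) (use rd[of k] w in simp)
      also have "\<dots> = 2 * ((d$k)\<^sup>2 * r\<^sup>2)" unfolding w by (simp add: power_mult_distrib mult.commute)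
      also have "\<dots> \<le> 2 * ((norm d)\<^sup>2 * r\<^sup>2)"
        using component_le_norm_cart[of d k] by (intro mult_left_mono mult_right_mono) (auto simp: abs_le_square_iff[symmetric])
      finally show ?thesis by simp
    qed
    then have "(\<Sum>k\<in>UNIV. \<bar>e \<theta> $ k\<bar>) \<le> (\<Sum>k\<in>(UNIV::'n set). 2 * (norm d)\<^sup>2 * r\<^sup>2)"
      by (intro sum_mono)
    then show ?thesis using norm_le_l1_cart[of "e \<theta>"] by (simp add: C_def algebra_simps)
  qed
  have XH: "X (H \<theta>) = r * cos \<theta> + X (e \<theta>)" and YH: "Y (H \<theta>) = Y (e \<theta>)" for \<theta>
  proof -
    have "H \<theta> = (r * cos \<theta>) *\<^sub>R d + e \<theta>" by (simp add: e_def)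
    then show "X (H \<theta>) = r * cos \<theta> + X (e \<theta>)" "Y (H \<theta>) = Y (e \<theta>)"
      by (simp_all only: X_add Y_add X_scale Y_scale Xd Yd) simp_all
  qed
  have Xe: "\<bar>X (e \<theta>)\<bar> \<le> C * r\<^sup>2 / norm d" for \<theta>
    using X_le[of "e \<theta>"] divide_right_mono[OF e_le[of \<theta>], of "norm d"] by simp
  have Ye: "norm (Y (e \<theta>)) \<le> 2 * (C * r\<^sup>2)" for \<theta>
    using Y_le[of "e \<theta>"] e_le[of \<theta>] by simp
  have inD: "t0 + H \<theta> \<in> D" for \<theta>
  proof -
    have eq: "t0 + H \<theta> - p = (t0 - p) + H \<theta>" by simp
    have "\<bar>r * cos \<theta>\<bar> \<le> r" using r by (simp add: abs_mult mult_left_le)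
    then have "\<bar>X (H \<theta>)\<bar> < min x0 (1 - x0)" using Xe[of \<theta>] r(3) XH[of \<theta>] by linarith
    moreover have "norm (Y (t0 - p) + Y (H \<theta>)) \<le> norm (Y (t0 - p)) + norm (Y (H \<theta>))"
      by (rule norm_triangle_ineq)
    ultimately show ?thesis
      unfolding D_def mem_Collect_eq eq X_add Y_add x0_def[symmetric] using Ye[of \<theta>] r by (auto simp: YH)
  qed
  \<comment> \<open>The gradient of \<open>q\<close> at \<open>t0\<close>. As \<open>q\<close> is
    quadratic, \<open>qdiff\<close> is exact; the linear term will average to zero.\<close>
  define w where "w = (((b - a) + \<epsilon> * (1 - 2 * x0) - 2 * M * (Y (t0 - p) \<bullet> d)) / (d \<bullet> d)) *\<^sub>R d + (2 * M) *\<^sub>R Y (t0 - p)"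
  have wH: "w \<bullet> h = ((b - a) + \<epsilon> * (1 - 2 * x0)) * X h + 2 * M * (Y (t0 - p) \<bullet> Y h)" for h
  proof -
    have "w \<bullet> h = ((b - a) + \<epsilon> * (1 - 2 * x0) - 2 * M * (Y (t0 - p) \<bullet> d)) * X h + 2 * M * (Y (t0 - p) \<bullet> h)"
      by (simp add: w_def X_def inner_add_left inner_commute[of h d])
    moreover have "Y (t0 - p) \<bullet> Y h = Y (t0 - p) \<bullet> h - X h * (Y (t0 - p) \<bullet> d)"
      unfolding Y_def[of h] by (simp add: inner_diff_right)
    ultimately show ?thesis by (simp only:) (simp add: algebra_simps)
  qed
  have qdiff: "q (t0 + h) - q t0 = w \<bullet> h - \<epsilon> * (X h)\<^sup>2 + M * (norm (Y h))\<^sup>2" for h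
  proof -
    have eq: "t0 + h - p = (t0 - p) + h" by simp
    have sq: "(norm (Y (t0 - p) + Y h))\<^sup>2 = (norm (Y (t0 - p)))\<^sup>2 + 2 * (Y (t0 - p) \<bullet> Y h) + (norm (Y h))\<^sup>2"
      by (simp add: power2_norm_eq_inner inner_add_left inner_add_right inner_commute)
    show ?thesis
      unfolding q_def wH eq X_add Y_add sq x0_def by (simp add: algebra_simps power2_eq_square)
  qed
  define G where "G \<theta> = F0 + w \<bullet> H \<theta> + (K * r ^ 4 - \<epsilon> * r\<^sup>2 / 2 * (cos \<theta>)\<^sup>2)" for \<theta>
  have fG: "f (t0 + H \<theta>) \<le> ereal (G \<theta>)" for \<theta>
  proof -
    have "f (t0 + H \<theta>) \<le> ereal (F0 + (q (t0 + H \<theta>) - q t0))"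
      using t0max[OF inD[of \<theta>]] by (cases "f (t0 + H \<theta>)") (auto simp: F0)
    also have "F0 + (q (t0 + H \<theta>) - q t0) \<le> G \<theta>"
    proof -
      have "(X (e \<theta>))\<^sup>2 \<le> (C * r\<^sup>2 / norm d)\<^sup>2"
        using power_mono[OF Xe[of \<theta>], of 2] by simp
      \<comment> \<open>Giving up half of the main square absorbs the cross term.\<close>
      moreover have "(X (H \<theta>))\<^sup>2 \<ge> (r * cos \<theta>)\<^sup>2 / 2 - (X (e \<theta>))\<^sup>2"
      proof -
        have "0 \<le> (r * cos \<theta> + 2 * X (e \<theta>))\<^sup>2" by simp
        then show ?thesis unfolding XH by (simp add: power2_eq_square algebra_simps)
      qed
      ultimately have "(X (H \<theta>))\<^sup>2 \<ge> (r * cos \<theta>)\<^sup>2 / 2 - (C * r\<^sup>2 / norm d)\<^sup>2" by simp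
      then have "\<epsilon> * (X (H \<theta>))\<^sup>2 \<ge> \<epsilon> * ((r * cos \<theta>)\<^sup>2 / 2 - (C * r\<^sup>2 / norm d)\<^sup>2)"
        using eps by (intro mult_left_mono) auto
      moreover have "M * (norm (Y (H \<theta>)))\<^sup>2 \<le> M * (2 * (C * r\<^sup>2))\<^sup>2"
        unfolding YH using M Ye[of \<theta>] by (intro mult_left_mono power_mono) auto
      ultimately show ?thesis
        unfolding qdiff G_def K_def
        by (simp add: power_mult_distrib power_divide field_simps)
    qed
    finally show ?thesis by simp
  qed
  have nz: "1 + of_real (r * d$k) * exp (\<i> * of_real \<theta>) \<noteq> 0" for k and \<theta> :: real
  proof
    assume "1 + of_real (r * d$k) * exp (\<i> * of_real \<theta>) = 0"
    then have "cmod (of_real (r * d$k) * exp (\<i> * of_real \<theta>)) = 1"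
      by (metis add_eq_0_iff norm_minus_cancel norm_one)
    then show False using rd[of k] by (simp add: norm_mult)
  qed
  have "continuous_on {0..2*pi} G"
    unfolding G_def H_def inner_vec_def using nz by (simp, intro continuous_intros) auto
  then have le: "f t0 \<le> ereal (integral {0..2*pi} G / (2*pi))"
  proof (rule sub[OF r(1), rotated])
    show "\<forall>k. \<bar>r * d$k\<bar> < 1" by (intro allI, rule less_trans[OF rd]) simp
  qed (use fG in \<open>auto simp: H_def\<close>)
  have "((\<lambda>\<theta>. \<Sum>k\<in>UNIV. w$k * H \<theta> $ k) has_integral (\<Sum>k\<in>(UNIV::'n set). w$k * 0)) {0..2*pi}"
  proof (intro has_integral_sum has_integral_mult_right)
    fix k
    have "\<bar>r * d$k\<bar> < 1" using rd[of k] by simp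
    from integral_ln_norm_one_plus_circle[OF this]
    show "((\<lambda>\<theta>. H \<theta> $ k) has_integral 0) {0..2*pi}" by (simp add: H_def)
  qed simp
  then have wint: "((\<lambda>\<theta>. w \<bullet> H \<theta>) has_integral 0) {0..2*pi}" by (simp add: inner_vec_def)
  have "((\<lambda>\<theta>. (cos \<theta>)\<^sup>2) has_integral ((2*pi)/2 + sin (2*(2*pi))/4 - (0/2 + sin (2*0)/4))) {0..2*pi}"
    by (rule fundamental_theorem_of_calculus)
       (auto intro!: derivative_eq_intros simp: has_real_derivative_iff_has_vector_derivative[symmetric] cos_double_cos diff_divide_distrib)
  then have cint: "((\<lambda>\<theta>. (cos \<theta>)\<^sup>2) has_integral pi) {0..2*pi}" by simp
  have cst: "((\<lambda>\<theta>. c) has_integral (c * (2*pi))) {0..2*pi}" for c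
    using has_integral_const_real[of c 0 "2*pi"] by (simp add: mult.commute)
  \<comment> \<open>The square of the cosine has mean 1/2, so the mean of \<open>G\<close> is
    \<open>F0 + r\<^sup>2 (K r\<^sup>2 - \<epsilon> / 4)\<close>, below \<open>F0\<close> by the
    choice of \<open>r\<close>.\<close>
  have "(G has_integral (F0 * (2*pi) + 0 + (K * r^4 * (2*pi) - \<epsilon> * r\<^sup>2 / 2 * pi))) {0..2*pi}"
    unfolding G_def by (intro has_integral_add has_integral_diff has_integral_mult_right wint cint cst)
  then have "integral {0..2*pi} G / (2*pi) = F0 + (K * r^4 - \<epsilon> * r\<^sup>2 / 4)"
    by (subst integral_unique) (auto simp: field_simps)
  moreover have "K * r^4 - \<epsilon> * r\<^sup>2 / 4 = r\<^sup>2 * (K * r\<^sup>2 - \<epsilon> / 4)"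
    by (simp add: algebra_simps power2_eq_square power4_eq_xxxx)
  moreover have "r\<^sup>2 * (K * r\<^sup>2 - \<epsilon> / 4) < 0" using r by (intro mult_pos_neg) auto
  ultimately show False using le F0 by simp
qed

section \<open>Polynomials and Lebesgue measure on complex vectors\<close>

text \<open>At a zero coordinate the value of \<open>ln\<close> is a mere convention; such points
  form a null set by \<open>AE_lborel_torus\<close>.\<close>

definition logmod :: "complex^'n \<Rightarrow> real^'n" where
  "logmod z = (\<chi> k. ln (cmod (z$k)))"

lemma logmod_measurable [measurable]: "(logmod :: complex^'n \<Rightarrow> real^'n) \<in> borel_measurable borel"
proof -
  have [measurable]: "(\<lambda>z::complex^'n. z$k) \<in> borel_measurable borel" for k
    by (intro borel_measurable_continuous_onI continuous_intros)
  have "logmod = (\<lambda>z::complex^'n. \<Sum>k\<in>UNIV. ln (cmod (z$k)) *\<^sub>R axis k (1::real))"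
    by (auto simp: logmod_def fun_eq_iff vec_eq_iff axis_def if_distrib cong: if_cong)
  moreover have "(\<lambda>z::complex^'n. \<Sum>k\<in>UNIV. ln (cmod (z$k)) *\<^sub>R axis k (1::real)) \<in> borel_measurable borel"
    by measurable
  ultimately show ?thesis by (simp only:)
qed

lemma prod_Basis_complex_vec:
  fixes f :: "complex^'n \<Rightarrow> 'b::comm_monoid_mult"
  shows "(\<Prod>b\<in>Basis. f b) = (\<Prod>k\<in>UNIV. f (axis k 1) * f (axis k \<i>))"
proof -
  have "(\<Prod>b\<in>Basis. f b) = (\<Prod>b\<in>(\<Union>k\<in>UNIV. {axis k 1, axis k \<i>}). f b)"
    by (rule prod.cong) (auto simp: Basis_vec_def Basis_complex_def)
  also have "\<dots> = (\<Prod>k\<in>UNIV. \<Prod>b\<in>{axis k 1, axis k \<i>}. f b)"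
    by (rule prod.UNION_disjoint) (auto simp: axis_eq_axis)
  also have "\<dots> = (\<Prod>k\<in>UNIV. f (axis k 1) * f (axis k \<i>))"
    by (intro prod.cong refl) (simp add: axis_eq_axis)
  finally show ?thesis .
qed

lemma inner_axis_complex:
  fixes z :: "complex^'n"
  shows "z \<bullet> axis k 1 = Re (z$k)" "z \<bullet> axis k \<i> = Im (z$k)"
  by (simp_all add: inner_axis inner_complex_def)

text \<open>Finitely many real hyperplanes are null. All real axes are treated, because a later
  majorant takes logarithms of real and imaginary parts separately.\<close>

lemma AE_lborel_inner_Basis_nonzero:
  "AE z in lborel. \<forall>b\<in>Basis. (z::'a::euclidean_space) \<bullet> b \<noteq> 0"
proof (rule AE_finite_allI)
  fix b :: 'a assume b: "b \<in> Basis"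
  have "negligible {z. b \<bullet> z = 0}" using b by (intro negligible_hyperplane) auto
  then have "{z. b \<bullet> z = 0} \<in> null_sets lborel"
    by (simp add: negligible_iff_null_sets null_sets_completion_iff borel_closed closed_hyperplane)
  then show "AE z in lborel. z \<bullet> b \<noteq> 0"
    by (rule AE_I') (auto simp: inner_commute)
qed simp

lemma AE_lborel_torus: "AE z in lborel. \<forall>k. (z::complex^'n) $ k \<noteq> 0"
  using AE_lborel_inner_Basis_nonzero
proof (rule AE_mp, intro AE_I2 impI allI)
  fix z :: "complex^'n" and k assume "\<forall>b\<in>Basis. z \<bullet> b \<noteq> 0"
  moreover have "axis k 1 \<in> (Basis :: (complex^'n) set)" by (auto simp: Basis_vec_def Basis_complex_def)
  ultimately show "z $ k \<noteq> 0" using inner_axis_complex(1)[of z k] by force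
qed

section \<open>Spans of monomials and their dilations\<close>

lemma continuous_on_monom [continuous_intros]: "continuous_on S (monom J)"
  unfolding monom_def by (intro continuous_intros)

lemma polys_measurable:
  assumes "P \<in> polys"
  shows "P \<in> borel_measurable borel"
proof -
  obtain F c where "P = (\<lambda>z. \<Sum>J\<in>F. c J * monom J z)"
    using assms by (auto simp: polys_def monom_span_def)
  then show ?thesis by (auto intro!: borel_measurable_continuous_onI continuous_intros)
qed

lemma monom_spanI:
  assumes "finite F" "F \<subseteq> S" "\<And>z. P z = (\<Sum>J\<in>F. c J * monom J z)"
  shows "P \<in> monom_span S"
proof -
  have "P = (\<lambda>z. \<Sum>J\<in>F. c J * monom J z)" using assms(3) by (rule ext)
  then show ?thesis using assms(1,2) unfolding monom_span_def mem_Collect_eq by blast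
qed

lemma monom_in_monom_span:
  assumes "J \<in> S" shows "(\<lambda>z. c * monom J z) \<in> monom_span S"
  by (rule monom_spanI[where F = "{J}" and c = "\<lambda>_. c"]) (use assms in auto)

lemma monom_span_add:
  assumes "P \<in> monom_span S" "Q \<in> monom_span S"
  shows "(\<lambda>z. P z + Q z) \<in> monom_span S"
proof -
  obtain F c G d where P: "finite F" "F \<subseteq> S" "P = (\<lambda>z. \<Sum>J\<in>F. c J * monom J z)"
    and Q: "finite G" "G \<subseteq> S" "Q = (\<lambda>z. \<Sum>J\<in>G. d J * monom J z)"
    using assms unfolding monom_span_def by blast
  let ?e = "\<lambda>J. (if J \<in> F then c J else 0) + (if J \<in> G then d J else 0)"
  have "P z + Q z = (\<Sum>J\<in>F \<union> G. ?e J * monom J z)" for z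
  proof -
    have "(\<Sum>J\<in>F. c J * monom J z) = (\<Sum>J\<in>F \<union> G. (if J \<in> F then c J else 0) * monom J z)"
      using P Q by (intro sum.mono_neutral_cong_left) auto
    moreover have "(\<Sum>J\<in>G. d J * monom J z) = (\<Sum>J\<in>F \<union> G. (if J \<in> G then d J else 0) * monom J z)"
      using P Q by (intro sum.mono_neutral_cong_left) auto
    ultimately show ?thesis
      by (simp only: P Q sum.distrib distrib_right)
  qed
  then show ?thesis
    using P Q by (intro monom_spanI[where F = "F \<union> G" and c = ?e]) auto
qed

lemma monom_span_cmult:
  assumes "P \<in> monom_span S" shows "(\<lambda>z. a * P z) \<in> monom_span S"
proof -
  obtain F c where P: "finite F" "F \<subseteq> S" "P = (\<lambda>z. \<Sum>J\<in>F. c J * monom J z)"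
    using assms unfolding monom_span_def by blast
  then show ?thesis
    by (intro monom_spanI[where F = F and c = "\<lambda>J. a * c J"]) (auto simp: sum_distrib_left mult.assoc)
qed

definition dilate :: "'n \<Rightarrow> complex^'n \<Rightarrow> complex^'n" where
  "dilate k z = (\<chi> j. if j = k then 2 * z$j else z$j)"

lemma monom_dilate: "monom J (dilate k z) = 2 ^ (J$k) * monom J z"
proof -
  have "monom J (dilate k z) = (\<Prod>j\<in>UNIV. (if j = k then 2 ^ (J$k) else 1) * (z$j) ^ (J$j))"
    unfolding monom_def dilate_def by (intro prod.cong) (auto simp: power_mult_distrib)
  also have "\<dots> = 2 ^ (J$k) * monom J z" by (simp add: prod.distrib monom_def)
  finally show ?thesis .
qed

lemma monom_span_dilate:
  assumes "P \<in> monom_span S" shows "(\<lambda>z. P (dilate k z)) \<in> monom_span S"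
proof -
  obtain F c where P: "finite F" "F \<subseteq> S" "P = (\<lambda>z. \<Sum>J\<in>F. c J * monom J z)"
    using assms unfolding monom_span_def by blast
  then show ?thesis
    by (intro monom_spanI[where F = F and c = "\<lambda>J. c J * 2 ^ (J$k)"]) (auto simp: monom_dilate mult.assoc)
qed

text \<open>Monomials are joint eigenfunctions of the dilations with distinct systems of eigenvalues,
  so applying \<open>dilate k - 2 ^ (J0$k)\<close> removes the \<open>J0\<close>-term.\<close>
lemma monomial_terms_in_dilation_invariant_space:
  fixes V :: "(complex^'n \<Rightarrow> complex) set"
  assumes add: "\<And>P Q. P \<in> V \<Longrightarrow> Q \<in> V \<Longrightarrow> (\<lambda>z. P z + Q z) \<in> V"
    and cmult: "\<And>a P. P \<in> V \<Longrightarrow> (\<lambda>z. a * P z) \<in> V"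
    and dil: "\<And>k P. P \<in> V \<Longrightarrow> (\<lambda>z. P (dilate k z)) \<in> V"
    and "finite F" "(\<lambda>z. \<Sum>J\<in>F. c J * monom J z) \<in> V" "J \<in> F"
  shows "(\<lambda>z. c J * monom J z) \<in> V"
  using assms(4-6)
proof (induction "card F" arbitrary: F c rule: less_induct)
  case less
  show ?case
  proof (cases "F = {J}")
    case True
    then show ?thesis using less.prems by simp
  next
    case False
    then obtain J0 where J0: "J0 \<in> F" "J0 \<noteq> J" using less.prems by blast
    then obtain k where k: "J0$k \<noteq> J$k" by (auto simp: vec_eq_iff)
    let ?P = "\<lambda>z. \<Sum>J\<in>F. c J * monom J z"
    let ?c = "\<lambda>I. c I * (2 ^ (I$k) - 2 ^ (J0$k))"
    have "(\<lambda>z. ?P (dilate k z) + (- (2 ^ (J0$k))) * ?P z) \<in> V"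
      by (intro add cmult dil[of ?P] less.prems)
    moreover have "?P (dilate k z) + (- (2 ^ (J0$k))) * ?P z = (\<Sum>I\<in>F - {J0}. ?c I * monom I z)" for z
    proof -
      have "?P (dilate k z) + (- (2 ^ (J0$k))) * ?P z = (\<Sum>I\<in>F. ?c I * monom I z)"
        by (simp add: monom_dilate sum_distrib_left sum_negf[symmetric] sum.distrib[symmetric] algebra_simps)
      also have "\<dots> = (\<Sum>I\<in>F - {J0}. ?c I * monom I z)"
        using J0 less.prems by (simp add: sum.remove[of F J0])
      finally show ?thesis .
    qed
    ultimately have V: "(\<lambda>z. \<Sum>I\<in>F - {J0}. ?c I * monom I z) \<in> V" by simp
    have "card (F - {J0}) < card F" using J0 less.prems by (meson card_Diff1_less)
    from less.hyps[OF this _ V] have "(\<lambda>z. ?c J * monom J z) \<in> V"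
      using J0 less.prems by simp
    then have "(\<lambda>z. inverse (2 ^ (J$k) - 2 ^ (J0$k)) * (?c J * monom J z)) \<in> V" by (rule cmult)
    moreover have "(2::complex) ^ (J$k) \<noteq> 2 ^ (J0$k)"
    proof
      assume "(2::complex) ^ (J$k) = 2 ^ (J0$k)"
      then have "(2::real) ^ (J$k) = 2 ^ (J0$k)" by (metis norm_numeral norm_power)
      then show False using k by simp
    qed
    then have "inverse (2 ^ (J$k) - 2 ^ (J0$k)) * (?c J * monom J z) = c J * monom J z" for z
      by (simp add: divide_simps)
    ultimately show ?thesis by simp
  qed
qed

text \<open>As a real map \<open>dilate k\<close> is diagonal with the entry 2 on two axes, so its
  determinant is 4; only that it is at least 1 enters.\<close>

lemma nn_integral_dilate_le:
  fixes f :: "complex^'n \<Rightarrow> ennreal"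
  assumes [measurable]: "f \<in> borel_measurable borel"
  shows "(\<integral>\<^sup>+z. f (dilate k z) \<partial>lborel) \<le> (\<integral>\<^sup>+z. f z \<partial>lborel)"
proof -
  define c :: "complex^'n \<Rightarrow> real" where "c b = (if b$k = 0 then 1 else 2)" for b
  have T: "0 + (\<Sum>b\<in>Basis. (c b * (x \<bullet> b)) *\<^sub>R b) = dilate k x" for x
  proof (rule euclidean_eqI)
    fix b :: "complex^'n" assume b: "b \<in> Basis"
    then obtain i w where iw: "b = axis i w" "w \<in> Basis" by (auto simp: Basis_vec_def)
    then have "w \<noteq> 0" by auto
    have bk: "b$k = (if i = k then w else 0)" by (simp add: iw axis_def)
    have "(0 + (\<Sum>b\<in>Basis. (c b * (x \<bullet> b)) *\<^sub>R b)) \<bullet> b = c b * (x \<bullet> b)" using b by simp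
    also have "\<dots> = dilate k x \<bullet> b"
      using \<open>w \<noteq> 0\<close> unfolding c_def bk by (simp add: iw inner_axis dilate_def inner_complex_def)
    finally show "(0 + (\<Sum>b\<in>Basis. (c b * (x \<bullet> b)) *\<^sub>R b)) \<bullet> b = dilate k x \<bullet> b" .
  qed
  have [measurable]: "dilate k \<in> borel_measurable borel"
    unfolding T[symmetric] by measurable
  have "lborel = density (distr lborel borel (\<lambda>x. 0 + (\<Sum>b\<in>Basis. (c b * (x \<bullet> b)) *\<^sub>R b))) (\<lambda>_. (\<Prod>b\<in>Basis. \<bar>c b\<bar>))"
    by (rule lborel_affine_euclidean) (auto simp: c_def)
  then have "(\<integral>\<^sup>+z. f z \<partial>lborel) = (\<integral>\<^sup>+z. f z \<partial>density (distr lborel borel (dilate k)) (\<lambda>_. (\<Prod>b\<in>Basis. \<bar>c b\<bar>)))"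
    by (simp only: T)
  also have "\<dots> = ennreal (\<Prod>b\<in>Basis. \<bar>c b\<bar>) * (\<integral>\<^sup>+z. f (dilate k z) \<partial>lborel)"
    by (simp add: nn_integral_density nn_integral_distr nn_integral_cmult)
  finally have *: "(\<integral>\<^sup>+z. f z \<partial>lborel) = ennreal (\<Prod>b\<in>Basis. \<bar>c b\<bar>) * (\<integral>\<^sup>+z. f (dilate k z) \<partial>lborel)" .
  have "1 \<le> (\<Prod>b\<in>Basis. \<bar>c b\<bar>)" by (rule prod_ge_1) (simp add: c_def)
  then have "1 * (\<integral>\<^sup>+z. f (dilate k z) \<partial>lborel) \<le> ennreal (\<Prod>b\<in>Basis. \<bar>c b\<bar>) * (\<integral>\<^sup>+z. f (dilate k z) \<partial>lborel)"
    by (intro mult_right_mono) auto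
  then show ?thesis by (simp add: *)
qed

text \<open>\<open>G x\<close> is \<open>1 / \<bar>x\<bar>\<close> times
  \<open>exp (- s \<bar>ln \<bar>x\<bar>\<bar>)\<close>: the exponents lie on the integrable side of
  -1 both at 0 and at infinity. It is the one-variable factor of the majorant for monomials.\<close>

lemma nn_integral_two_sided_powr_finite:
  fixes s :: real
  assumes s: "s > 0"
  defines "G \<equiv> \<lambda>x::real. if \<bar>x\<bar> \<le> 1 then \<bar>x\<bar> powr (s - 1) else \<bar>x\<bar> powr (- s - 1)"
  shows "(\<integral>\<^sup>+x. ennreal (G x) \<partial>lborel) < \<infinity>"
proof -
  define A where "A x = ennreal (x powr (s - 1)) * indicator {0..1} x + ennreal (x powr (- s - 1)) * indicator {1..} x" for x :: real
  have [measurable]: "A \<in> borel_measurable borel" unfolding A_def by measurable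
  have 1: "(\<integral>\<^sup>+x. ennreal (x powr (s - 1)) * indicator {0..1} x \<partial>lborel) = ennreal (1 powr (s - 1 + 1) / (s - 1 + 1))"
    using s by (intro nn_integral_has_integral_lebesgue' has_integral_powr_from_0) auto
  have 2: "(\<integral>\<^sup>+x. ennreal (x powr (- s - 1)) * indicator {1..} x \<partial>lborel) = ennreal (- (1 powr (- s - 1 + 1)) / (- s - 1 + 1))"
    using s by (intro nn_integral_has_integral_lebesgue' has_integral_powr_to_inf) auto
  have A: "(\<integral>\<^sup>+x. A x \<partial>lborel) < \<infinity>"
    unfolding A_def by (subst nn_integral_add) (auto simp: 1 2 ennreal_add_eq_top less_top)
  have A': "(\<integral>\<^sup>+x. A (- x) \<partial>lborel) = (\<integral>\<^sup>+x. A x \<partial>lborel)"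
    using nn_integral_real_affine[of A "-1" 0] by simp
  have "(\<integral>\<^sup>+x. ennreal (G x) \<partial>lborel) \<le> (\<integral>\<^sup>+x. A x + A (- x) \<partial>lborel)"
    by (intro nn_integral_mono) (auto simp: G_def A_def indicator_def abs_if not_le)
  also have "\<dots> = (\<integral>\<^sup>+x. A x \<partial>lborel) + (\<integral>\<^sup>+x. A (- x) \<partial>lborel)" by (rule nn_integral_add) auto
  also have "\<dots> < \<infinity>" using A A' by (simp add: less_top ennreal_add_eq_top)
  finally show ?thesis .
qed

section \<open>Square integrability for toric weights\<close>

lemma cmod_monom_eq_exp:
  fixes z :: "complex^'n"
  assumes "\<And>k. z$k \<noteq> 0"
  shows "cmod (monom J z) = exp ((\<chi> k. real (J$k)) \<bullet> logmod z)"
proof -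
  have "cmod (monom J z) = (\<Prod>k\<in>UNIV. exp (real (J$k) * ln (cmod (z$k))))"
    unfolding monom_def prod_norm[symmetric]
  proof (intro prod.cong refl)
    fix k
    have "cmod (z$k ^ J$k) = cmod (z$k) powr real (J$k)" using assms by (simp add: norm_power powr_realpow)
    then show "cmod (z$k ^ J$k) = exp (real (J$k) * ln (cmod (z$k)))" using assms by (simp add: powr_def)
  qed
  also have "\<dots> = exp ((\<chi> k. real (J$k)) \<bullet> logmod z)"
    by (simp add: exp_sum inner_vec_def logmod_def)
  finally show ?thesis .
qed

text \<open>A pair, so that a weight with its recession function and the recession function with
  itself are both instances and share \<psi>. The condition \<open>psi_nonneg\<close> is what
  remains of the growth to infinity.\<close>

locale toric_weight =
  fixes \<phi> \<psi> :: "real^'n \<Rightarrow> real" and K :: real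
  assumes phi_add_le: "\<phi> (t + s) \<le> \<phi> t + \<psi> s"
    and phi_lower: "\<epsilon> > 0 \<Longrightarrow> \<exists>C. \<forall>t. \<psi> t - \<epsilon> * norm t - C \<le> \<phi> t"
    and psi_le: "\<psi> t \<le> K * norm t"
    and K_nonneg: "K \<ge> 0"
    and psi_scale: "c > 0 \<Longrightarrow> \<psi> (c *\<^sub>R t) = c * \<psi> t"
    and psi_add_le: "\<psi> (t + s) \<le> \<psi> t + \<psi> s"
    and psi_nonneg: "t$k > 0 \<Longrightarrow> \<psi> t \<ge> 0"
begin

lemma phi_diff_le: "\<phi> t - \<phi> s \<le> K * norm (t - s)"
  using phi_add_le[of s "t - s"] psi_le[of "t - s"] by simp

lemma psi_diff_le: "\<psi> t - \<psi> s \<le> K * norm (t - s)"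
  using psi_add_le[of s "t - s"] psi_le[of "t - s"] by simp

lemma continuous_on_lipschitz:
  assumes "\<And>t s. f t - f s \<le> K * norm (t - s)"
  shows "continuous_on S (f :: real^'n \<Rightarrow> real)"
proof -
  have "K-lipschitz_on S f"
  proof (rule lipschitz_onI)
    show "dist (f t) (f s) \<le> K * dist t s" for t s
      using assms[of t s] assms[of s t] by (simp add: dist_norm abs_le_iff norm_minus_commute)
  qed (rule K_nonneg)
  then show ?thesis by (rule lipschitz_on_continuous_on)
qed

lemma continuous_on_phi: "continuous_on S \<phi>" and continuous_on_psi: "continuous_on S \<psi>"
  using continuous_on_lipschitz phi_diff_le psi_diff_le by blast+

lemma phi_measurable [measurable]: "\<phi> \<in> borel_measurable borel"
  by (rule borel_measurable_continuous_onI[OF continuous_on_phi])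

text \<open>The positive continuous difference has a positive minimum on the unit sphere, and
  homogeneity spreads it over all rays.\<close>

lemma support_gap:
  assumes lt: "\<And>t. t \<noteq> 0 \<Longrightarrow> a \<bullet> t < max (\<psi> t) 0"
  shows "\<exists>\<delta>>0. \<forall>t. a \<bullet> t + \<delta> * norm t \<le> max (\<psi> t) 0"
proof -
  let ?g = "\<lambda>t. max (\<psi> t) 0 - a \<bullet> t"
  have "continuous_on (sphere 0 1) ?g" by (intro continuous_intros continuous_on_psi)
  moreover have "sphere (0::real^'n) 1 \<noteq> {}" by simp
  ultimately obtain m where m: "m \<in> sphere 0 1" "\<And>t. t \<in> sphere 0 1 \<Longrightarrow> ?g m \<le> ?g t"
    using continuous_attains_inf[OF compact_sphere] by blast
  have "?g m > 0" using m lt[of m] by fastforce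
  moreover have "a \<bullet> t + ?g m * norm t \<le> max (\<psi> t) 0" for t
  proof (cases "t = 0")
    case False
    let ?e = "inverse (norm t) *\<^sub>R t"
    have t: "t = norm t *\<^sub>R ?e" using False by simp
    have "?g m \<le> ?g ?e" using False by (intro m) simp
    then have "norm t * ?g m \<le> norm t * ?g ?e" by (intro mult_left_mono) auto
    also have "\<dots> = max (norm t * \<psi> ?e) 0 - norm t * (a \<bullet> ?e)"
      by (simp add: right_diff_distrib max_mult_distrib_left)
    also have "norm t * \<psi> ?e = \<psi> t" using psi_scale[of "norm t" ?e] t False by simp
    also have "norm t * (a \<bullet> ?e) = a \<bullet> t" using False by simp
    finally show ?thesis by (simp add: algebra_simps)
  qed simp
  ultimately show ?thesis by blast
qed

definition weight :: "(complex^'n \<Rightarrow> complex) \<Rightarrow> complex^'n \<Rightarrow> real" where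
  "weight P z = (cmod (P z))\<^sup>2 * exp (- 2 * \<phi> (logmod z))"

definition tail_norm :: "real \<Rightarrow> (complex^'n \<Rightarrow> complex) \<Rightarrow> ennreal" where
  "tail_norm \<rho> P = (\<integral>\<^sup>+z. ennreal (weight P z) * indicator {z. norm z > \<rho>} z \<partial>lborel)"

lemma tail_norm_antimono: "\<rho> \<le> \<rho>' \<Longrightarrow> tail_norm \<rho>' P \<le> tail_norm \<rho> P"
  unfolding tail_norm_def by (intro nn_integral_mono mult_left_mono) (auto simp: indicator_def)

lemma weight_measurable [measurable]:
  assumes [measurable]: "P \<in> borel_measurable borel"
  shows "weight P \<in> borel_measurable borel"
  unfolding weight_def by measurable

text \<open>Compact sets can be exchanged for balls, and values of \<open>v\<close> off the torus
  sit on a null set.\<close>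

lemma P_inf_eq:
  assumes v: "\<And>z. (\<forall>k. z$k \<noteq> 0) \<Longrightarrow> v z = ereal (\<phi> (logmod z))"
  shows "P_inf v = {P \<in> polys. \<exists>\<rho>. tail_norm \<rho> P < \<infinity>}"
proof -
  have eq: "(\<integral>\<^sup>+ z\<in>UNIV - A. (ennreal (cmod (P z)) * eexp (- v z))\<^sup>2 \<partial>lborel)
      = (\<integral>\<^sup>+ z\<in>UNIV - A. ennreal (weight P z) \<partial>lborel)" for A P
  proof (rule nn_integral_cong_AE, rule AE_mp[OF AE_lborel_torus], intro AE_I2 impI)
    fix z :: "complex^'n" assume "\<forall>k. z$k \<noteq> 0"
    then have "(ennreal (cmod (P z)) * eexp (- v z))\<^sup>2 = ennreal (weight P z)"
      by (simp add: v weight_def power_mult_distrib ennreal_power ennreal_mult[symmetric] exp_of_nat_mult[symmetric]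
          flip: exp_double)
    then show "(ennreal (cmod (P z)) * eexp (- v z))\<^sup>2 * indicator (UNIV - A) z
        = ennreal (weight P z) * indicator (UNIV - A) z" by simp
  qed
  have "L2_inf (\<lambda>z. ennreal (cmod (P z)) * eexp (- v z)) \<longleftrightarrow> (\<exists>\<rho>. tail_norm \<rho> P < \<infinity>)" for P
    unfolding L2_inf_def eq
  proof
    assume "\<exists>A. compact A \<and> (\<integral>\<^sup>+ z\<in>UNIV - A. ennreal (weight P z) \<partial>lborel) < \<infinity>"
    then obtain A where A: "compact A" "(\<integral>\<^sup>+ z\<in>UNIV - A. ennreal (weight P z) \<partial>lborel) < \<infinity>" by blast
    then obtain \<rho> where \<rho>: "\<And>z. z \<in> A \<Longrightarrow> norm z \<le> \<rho>" by (meson bounded_iff compact_imp_bounded)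
    have "tail_norm \<rho> P \<le> (\<integral>\<^sup>+ z\<in>UNIV - A. ennreal (weight P z) \<partial>lborel)"
      unfolding tail_norm_def using \<rho> by (intro nn_integral_mono mult_left_mono) (force simp: indicator_def)+
    then show "\<exists>\<rho>. tail_norm \<rho> P < \<infinity>" using A le_less_trans by blast
  next
    assume "\<exists>\<rho>. tail_norm \<rho> P < \<infinity>"
    then obtain \<rho> where "tail_norm \<rho> P < \<infinity>" by blast
    moreover have "{z. norm z > \<rho>} = UNIV - cball (0::complex^'n) \<rho>" by auto
    ultimately have "(\<integral>\<^sup>+ z\<in>UNIV - cball 0 \<rho>. ennreal (weight P z) \<partial>lborel) < \<infinity>"
      by (simp add: tail_norm_def)
    then show "\<exists>A. compact A \<and> (\<integral>\<^sup>+ z\<in>UNIV - A. ennreal (weight P z) \<partial>lborel) < \<infinity>"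
      using compact_cball by blast
  qed
  then show ?thesis unfolding P_inf_def by simp
qed

section \<open>Invariance of the space of polynomials with finite tail\<close>

definition tail_polys :: "(complex^'n \<Rightarrow> complex) set" where
  "tail_polys = {P \<in> polys. \<exists>\<rho>. tail_norm \<rho> P < \<infinity>}"

lemma tail_polys_add:
  assumes "P \<in> tail_polys" "Q \<in> tail_polys"
  shows "(\<lambda>z. P z + Q z) \<in> tail_polys"
proof -
  obtain \<rho>1 \<rho>2 where fin: "tail_norm \<rho>1 P < \<infinity>" "tail_norm \<rho>2 Q < \<infinity>" and pol: "P \<in> polys" "Q \<in> polys"
    using assms by (auto simp: tail_polys_def)
  define \<rho> where "\<rho> = max \<rho>1 \<rho>2"
  note [measurable] = polys_measurable[OF pol(1)] polys_measurable[OF pol(2)]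
  have le: "weight (\<lambda>z. P z + Q z) z \<le> 2 * weight P z + 2 * weight Q z" for z
  proof -
    have "(cmod (P z + Q z))\<^sup>2 \<le> (cmod (P z) + cmod (Q z))\<^sup>2"
      by (intro power_mono norm_triangle_ineq) auto
    also have "\<dots> \<le> 2 * (cmod (P z))\<^sup>2 + 2 * (cmod (Q z))\<^sup>2"
      using sum_squares_bound[of "cmod (P z)" "cmod (Q z)"] by (simp add: power2_sum)
    finally have "weight (\<lambda>z. P z + Q z) z \<le> (2 * (cmod (P z))\<^sup>2 + 2 * (cmod (Q z))\<^sup>2) * exp (- 2 * \<phi> (logmod z))"
      unfolding weight_def by (intro mult_right_mono) auto
    then show ?thesis by (simp add: weight_def algebra_simps)
  qed
  have "ennreal (weight (\<lambda>z. P z + Q z) z) \<le> 2 * ennreal (weight P z) + 2 * ennreal (weight Q z)" for z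
  proof -
    have "weight P z \<ge> 0" "weight Q z \<ge> 0" by (simp_all add: weight_def)
    then have "2 * ennreal (weight P z) + 2 * ennreal (weight Q z) = ennreal (2 * weight P z + 2 * weight Q z)"
      by (simp add: ennreal_mult')
    then show ?thesis using le[of z] by (simp only:) (rule ennreal_leI)
  qed
  then have "tail_norm \<rho> (\<lambda>z. P z + Q z)
      \<le> (\<integral>\<^sup>+z. 2 * (ennreal (weight P z) * indicator {z. norm z > \<rho>} z)
             + 2 * (ennreal (weight Q z) * indicator {z. norm z > \<rho>} z) \<partial>lborel)"
    unfolding tail_norm_def by (intro nn_integral_mono) (simp add: indicator_def)
  also have "\<dots> = 2 * tail_norm \<rho> P + 2 * tail_norm \<rho> Q"
    unfolding tail_norm_def by (subst nn_integral_add) (auto simp: nn_integral_cmult)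
  also have "\<dots> < \<infinity>"
    using fin tail_norm_antimono[of \<rho>1 \<rho> P] tail_norm_antimono[of \<rho>2 \<rho> Q]
    by (auto simp: \<rho>_def less_top[symmetric] ennreal_mult_eq_top_iff ennreal_add_eq_top top_unique)
  finally show ?thesis
    using pol monom_span_add by (auto simp: tail_polys_def polys_def)
qed

lemma tail_polys_cmult:
  assumes "P \<in> tail_polys"
  shows "(\<lambda>z. a * P z) \<in> tail_polys"
proof -
  obtain \<rho> where fin: "tail_norm \<rho> P < \<infinity>" and pol: "P \<in> polys" using assms by (auto simp: tail_polys_def)
  note [measurable] = polys_measurable[OF pol]
  have "weight (\<lambda>z. a * P z) z = (cmod a)\<^sup>2 * weight P z" for z
    by (simp add: weight_def norm_mult power_mult_distrib)
  then have "tail_norm \<rho> (\<lambda>z. a * P z) = ennreal ((cmod a)\<^sup>2) * tail_norm \<rho> P"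
    unfolding tail_norm_def by (simp add: ennreal_mult' mult.assoc nn_integral_cmult)
  also have "\<dots> < \<infinity>" using fin by (simp add: ennreal_mult_less_top)
  finally show ?thesis using pol monom_span_cmult by (auto simp: tail_polys_def polys_def)
qed

text \<open>A dilation moves \<open>logmod z\<close> by at most \<open>ln 2\<close>, so the
  Lipschitz bound on \<phi> changes the weight by a bounded factor; it does not decrease norms, so
  tails go into tails.\<close>

lemma tail_polys_dilate:
  assumes "P \<in> tail_polys"
  shows "(\<lambda>z. P (dilate k z)) \<in> tail_polys"
proof -
  obtain \<rho> where fin: "tail_norm \<rho> P < \<infinity>" and pol: "P \<in> polys" using assms by (auto simp: tail_polys_def)
  note [measurable] = polys_measurable[OF pol]
  have le: "weight (\<lambda>z. P (dilate k z)) z \<le> exp (2 * (K * ln 2)) * weight P (dilate k z)" for z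
  proof -
    have "norm (logmod (dilate k z) - logmod z) \<le> (\<Sum>j\<in>UNIV. \<bar>(logmod (dilate k z) - logmod z) $ j\<bar>)"
      by (rule norm_le_l1_cart)
    also have "\<dots> \<le> (\<Sum>j\<in>UNIV. if j = k then ln 2 else 0)"
      by (intro sum_mono) (auto simp: logmod_def dilate_def norm_mult ln_mult)
    finally have "norm (logmod (dilate k z) - logmod z) \<le> ln 2" by simp
    then have "K * norm (logmod (dilate k z) - logmod z) \<le> K * ln 2" using K_nonneg by (rule mult_left_mono)
    then have "- 2 * \<phi> (logmod z) \<le> 2 * (K * ln 2) + (- 2 * \<phi> (logmod (dilate k z)))"
      using phi_diff_le[of "logmod (dilate k z)" "logmod z"] by linarith
    then have "exp (- 2 * \<phi> (logmod z)) \<le> exp (2 * (K * ln 2)) * exp (- 2 * \<phi> (logmod (dilate k z)))"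
      by (simp add: exp_add[symmetric])
    then have "(cmod (P (dilate k z)))\<^sup>2 * exp (- 2 * \<phi> (logmod z))
        \<le> (cmod (P (dilate k z)))\<^sup>2 * (exp (2 * (K * ln 2)) * exp (- 2 * \<phi> (logmod (dilate k z))))"
      by (intro mult_left_mono) auto
    then show ?thesis by (simp add: weight_def algebra_simps)
  qed
  have nd: "norm z \<le> norm (dilate k z)" for z :: "complex^'n"
    unfolding norm_vec_def dilate_def by (intro L2_set_mono) (auto simp: norm_mult)
  let ?f = "\<lambda>z. ennreal (weight P z) * indicator {z. norm z > \<rho>} z"
  have "tail_norm \<rho> (\<lambda>z. P (dilate k z)) \<le> (\<integral>\<^sup>+z. ennreal (exp (2 * (K * ln 2))) * ?f (dilate k z) \<partial>lborel)"
    unfolding tail_norm_def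
  proof (intro nn_integral_mono)
    fix z :: "complex^'n"
    have "ennreal (weight (\<lambda>z. P (dilate k z)) z) \<le> ennreal (exp (2 * (K * ln 2))) * ennreal (weight P (dilate k z))"
      using ennreal_leI[OF le[of z]] by (simp add: ennreal_mult')
    moreover have "norm z > \<rho> \<Longrightarrow> norm (dilate k z) > \<rho>" using nd[of z] by simp
    ultimately show "ennreal (weight (\<lambda>z. P (dilate k z)) z) * indicator {z. norm z > \<rho>} z
        \<le> ennreal (exp (2 * (K * ln 2))) * ?f (dilate k z)"
      by (auto simp: indicator_def)
  qed
  also have "\<dots> \<le> (\<integral>\<^sup>+z. ennreal (exp (2 * (K * ln 2))) * ?f z \<partial>lborel)"
    by (rule nn_integral_dilate_le) measurable
  also have "\<dots> = ennreal (exp (2 * (K * ln 2))) * tail_norm \<rho> P"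
    unfolding tail_norm_def by (rule nn_integral_cmult) measurable
  also have "\<dots> < \<infinity>" using fin by (simp add: ennreal_mult_less_top)
  finally show ?thesis using pol monom_span_dilate by (auto simp: tail_polys_def polys_def)
qed

text \<open>Half of the strict gap pays for the error in \<open>phi_lower\<close>; the rest leaves
  \<open>exp (- \<delta> |t|)\<close> beyond the factor that compensates the Jacobian. This is
  dominated by a product of one-variable functions, and Tonelli applies.\<close>

lemma monom_tail_finite:
  assumes lt: "\<And>t. t \<noteq> 0 \<Longrightarrow> (\<chi> k. real (J$k) + 1) \<bullet> t < max (\<psi> t) 0"
  shows "tail_norm (real CARD('n)) (monom J) < \<infinity>"
proof -
  let ?a = "\<chi> k. real (J$k) + 1"
  obtain \<delta>0 where d0: "\<delta>0 > 0" "\<And>t. ?a \<bullet> t + \<delta>0 * norm t \<le> max (\<psi> t) 0" using support_gap[OF lt] by blast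
  \<comment> \<open>The cap 2 yields \<open>s \<le> 1\<close>, which makes \<open>h\<close>
    monotone.\<close>
  define \<delta> where "\<delta> = min \<delta>0 2"
  have d: "\<delta> > 0" "\<delta> \<le> 2" using d0 by (auto simp: \<delta>_def)
  have gap: "?a \<bullet> t + \<delta> * norm t \<le> max (\<psi> t) 0" for t
    using d0(2)[of t] mult_right_mono[of \<delta> \<delta>0 "norm t"] by (simp add: \<delta>_def)
  obtain C where C: "\<And>t. \<psi> t - \<delta>/2 * norm t - C \<le> \<phi> t" using phi_lower[of "\<delta>/2"] d by auto
  \<comment> \<open>Chosen so that \<open>2 * s\<close> times the sum of the
    \<open>\<bar>t$k\<bar>\<close> is at most \<open>\<delta> * norm t\<close>, which separates the
    variables.\<close>
  define s where "s = \<delta> / real CARD('n) / 2"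
  have s: "s > 0" "s \<le> 1" using d by (auto simp: s_def divide_simps intro: order_trans[OF d(2)])
  define G where "G = (\<lambda>x::real. if \<bar>x\<bar> \<le> 1 then \<bar>x\<bar> powr (s - 1) else \<bar>x\<bar> powr (- s - 1))"
  have [measurable]: "G \<in> borel_measurable borel" unfolding G_def by measurable
  \<comment> \<open>\<open>2 h (ln |z_k|)\<close> is the exponent in the k-th variable. By
    monotonicity one copy of \<open>|z_k|\<close> may be lowered to the modulus of the real part,
    the other to that of the imaginary part.\<close>
  define h where "h x = x + s * \<bar>x\<bar>" for x
  have h_mono: "h x \<le> h y" if "x \<le> y" for x y
  proof -
    have "s * (\<bar>x\<bar> - \<bar>y\<bar>) \<le> s * (y - x)" using that s by (intro mult_left_mono) auto
    also have "\<dots> \<le> 1 * (y - x)" using that s by (intro mult_right_mono) auto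
    finally show ?thesis by (simp add: h_def algebra_simps)
  qed
  have G_exp: "G x = exp (- h (ln \<bar>x\<bar>))" if "x \<noteq> 0" for x
    using that by (auto simp: G_def h_def powr_def algebra_simps)
  have bound: "ennreal (weight (monom J) z) * indicator {z. norm z > real CARD('n)} z
      \<le> ennreal (exp (2 * C)) * (\<Prod>b\<in>Basis. ennreal (G (z \<bullet> b)))"
    if nzb: "\<forall>b\<in>Basis. z \<bullet> b \<noteq> 0" for z :: "complex^'n"
  proof (cases "norm z > real CARD('n)")
    case False
    then show ?thesis by simp
  next
    case True
    have bas: "axis k 1 \<in> (Basis :: (complex^'n) set)" "axis k \<i> \<in> (Basis :: (complex^'n) set)" for k
      by (auto simp: Basis_vec_def Basis_complex_def)
    have re: "Re (z$k) \<noteq> 0" and im: "Im (z$k) \<noteq> 0" for k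
      using nzb bas[of k] by (metis inner_axis_complex)+
    then have nz: "z$k \<noteq> 0" for k by (metis zero_complex.sel(1))
    \<comment> \<open>The radius \<open>CARD('n)\<close> serves this: with all moduli at most 1 the
      norm could not exceed it.\<close>
    have "\<exists>k. cmod (z$k) > 1"
    proof (rule ccontr)
      assume "\<not> ?thesis"
      then have "(\<Sum>k\<in>UNIV. norm (z$k)) \<le> (\<Sum>k\<in>(UNIV::'n set). 1)" by (intro sum_mono) (auto simp: not_less)
      then show False using True L2_set_le_sum[of UNIV "\<lambda>k. norm (z$k)"] by (simp add: norm_vec_def)
    qed
    then obtain k where "cmod (z$k) > 1" by blast
    then have "logmod z $ k > 0" by (simp add: logmod_def ln_gt_zero)
    then have psi0: "\<psi> (logmod z) \<ge> 0" by (rule psi_nonneg)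
    let ?t = "logmod z"
    have aJ: "(\<chi> k. real (J$k)) \<bullet> ?t = ?a \<bullet> ?t - (\<Sum>k\<in>UNIV. ?t$k)"
      by (simp add: inner_vec_def distrib_right sum.distrib)
    have "weight (monom J) z = exp (2 * ((\<chi> k. real (J$k)) \<bullet> ?t) - 2 * \<phi> ?t)"
      using nz by (simp add: weight_def cmod_monom_eq_exp exp_diff exp_minus divide_inverse flip: exp_double)
    also have "2 * ((\<chi> k. real (J$k)) \<bullet> ?t) - 2 * \<phi> ?t \<le> 2 * C + (- 2 * (\<Sum>k\<in>UNIV. ?t$k) - \<delta> * norm ?t)"
      using gap[of ?t] C[of ?t] psi0 unfolding aJ by simp
    also have "- 2 * (\<Sum>k\<in>UNIV. ?t$k) - \<delta> * norm ?t \<le> (\<Sum>k\<in>UNIV. - 2 * h (?t$k))"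
    proof -
      have "(\<Sum>k\<in>UNIV. \<bar>?t$k\<bar>) \<le> (\<Sum>k\<in>(UNIV::'n set). norm ?t)"
        by (intro sum_mono component_le_norm_cart)
      then have "\<delta> / real CARD('n) * (\<Sum>k\<in>UNIV. \<bar>?t$k\<bar>) \<le> \<delta> / real CARD('n) * (real CARD('n) * norm ?t)"
        using d by (intro mult_left_mono) auto
      then have "2 * s * (\<Sum>k\<in>UNIV. \<bar>?t$k\<bar>) \<le> \<delta> * norm ?t" by (simp add: s_def)
      then show ?thesis
        by (simp add: h_def sum.distrib sum_distrib_left sum_negf sum_subtractf algebra_simps)
    qed
    also have "(\<Sum>k\<in>UNIV. - 2 * h (?t$k)) \<le> (\<Sum>k\<in>UNIV. - h (ln \<bar>Re (z$k)\<bar>) - h (ln \<bar>Im (z$k)\<bar>))"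
    proof (intro sum_mono)
      fix k
      have "ln \<bar>Re (z$k)\<bar> \<le> ?t$k" "ln \<bar>Im (z$k)\<bar> \<le> ?t$k"
        using re[of k] im[of k] nz[of k] abs_Re_le_cmod[of "z$k"] abs_Im_le_cmod[of "z$k"]
        by (auto simp: logmod_def intro!: ln_mono)
      then show "- 2 * h (?t$k) \<le> - h (ln \<bar>Re (z$k)\<bar>) - h (ln \<bar>Im (z$k)\<bar>)"
        using h_mono by (smt (verit))
    qed
    finally have "weight (monom J) z \<le> exp (2 * C + (\<Sum>k\<in>UNIV. - h (ln \<bar>Re (z$k)\<bar>) - h (ln \<bar>Im (z$k)\<bar>)))"
      by simp
    also have "\<dots> = exp (2 * C) * (\<Prod>k\<in>UNIV. G (Re (z$k)) * G (Im (z$k)))"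
      using re im by (simp add: exp_add exp_sum G_exp exp_diff exp_minus divide_inverse)
    also have "\<dots> = exp (2 * C) * (\<Prod>b\<in>Basis. G (z \<bullet> b))"
      by (simp add: prod_Basis_complex_vec inner_axis_complex)
    finally have "ennreal (weight (monom J) z) \<le> ennreal (exp (2 * C) * (\<Prod>b\<in>Basis. G (z \<bullet> b)))"
      by (rule ennreal_leI)
    also have "\<dots> = ennreal (exp (2 * C)) * (\<Prod>b\<in>Basis. ennreal (G (z \<bullet> b)))"
      by (simp add: ennreal_mult' prod_ennreal G_def)
    finally show ?thesis using True by simp
  qed
  have "tail_norm (real CARD('n)) (monom J)
      \<le> (\<integral>\<^sup>+z. ennreal (exp (2 * C)) * (\<Prod>b\<in>Basis. ennreal (G (z \<bullet> b))) \<partial>(lborel :: (complex^'n) measure))"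
    unfolding tail_norm_def
    by (rule nn_integral_mono_AE, rule AE_mp[OF AE_lborel_inner_Basis_nonzero]) (intro AE_I2 impI bound)
  also have "\<dots> = ennreal (exp (2 * C)) * (\<Prod>b\<in>(Basis :: (complex^'n) set). (\<integral>\<^sup>+x. ennreal (G x) \<partial>lborel))"
    using nn_integral_lborel_prod[of "\<lambda>(_::complex^'n) x. ennreal (G x)"]
    by (subst nn_integral_cmult) auto
  also have "\<dots> < \<infinity>"
    using nn_integral_two_sided_powr_finite[OF s(1)]
    by (auto simp: G_def ennreal_mult_less_top power_less_top_ennreal)
  finally show ?thesis .
qed


text \<open>If \<open>J + 1\<close> fails the strict inequality at \<open>t\<close>, the weight has mass bounded below on infinitely
  many disjoint boxes placed along the ray through \<open>t\<close> in logarithmic coordinates.\<close>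
lemma monom_tail_finite_imp:
  assumes fin: "tail_norm \<rho> (monom J) < \<infinity>" and "t \<noteq> 0"
  shows "(\<chi> k. real (J$k) + 1) \<bullet> t < max (\<psi> t) 0"
proof (cases "\<exists>k. t$k > 0")
  \<comment> \<open>All coordinates of \<open>t\<close> are at most 0 and one is negative, while
    \<open>J + 1\<close> has positive entries.\<close>
  case False
  then have np: "t$k \<le> 0" for k by (auto simp: not_less)
  obtain k where k: "t$k \<noteq> 0" using \<open>t \<noteq> 0\<close> by (auto simp: vec_eq_iff)
  have "(\<Sum>j\<in>UNIV. (real (J$j) + 1) * t$j) < (\<Sum>j\<in>(UNIV::'n set). 0)"
  proof (rule sum_strict_mono_ex1)
    have "(real (J$k) + 1) * t$k < 0" using k np[of k] by (intro mult_pos_neg) auto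
    then show "\<exists>j\<in>UNIV. (real (J$j) + 1) * t$j < 0" by blast
  qed (auto intro: mult_nonneg_nonpos np)
  then show ?thesis by (simp add: inner_vec_def)
next
  case True
  then obtain k0 where k0: "t$k0 > 0" by blast
  let ?a = "\<chi> k. real (J$k) + 1"
  show ?thesis
  proof (rule ccontr)
    assume contra: "\<not> ?thesis"
    \<comment> \<open>Normalised so that one step along the ray multiplies the scale of coordinate
      \<open>k0\<close> by \<open>exp 2\<close>, more than the factor \<open>exp 1\<close> by which
      moduli vary inside a box. This makes the boxes disjoint.\<close>
    define \<tau> where "\<tau> = (2 / t$k0) *\<^sub>R t"
    have tau0: "\<tau>$k0 = 2" using k0 by (simp add: \<tau>_def)
    have "\<psi> \<tau> = (2 / t$k0) * \<psi> t" unfolding \<tau>_def using k0 by (intro psi_scale) simp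
    moreover have "?a \<bullet> \<tau> = (2 / t$k0) * (?a \<bullet> t)" by (simp add: \<tau>_def)
    moreover have "\<psi> t \<le> ?a \<bullet> t" using contra by simp
    ultimately have a_tau: "\<psi> \<tau> \<le> ?a \<bullet> \<tau>"
      using k0 by (simp add: divide_right_mono)
    define E where "E j k = exp (real j * \<tau>$k)" for j k
    have E: "E j k > 0" for j k by (simp add: E_def)
    \<comment> \<open>In each coordinate a square of side \<open>E j k\<close> with lower left
      corner at \<open>E j k\<close>; its area offsets the Jacobian factor, and its moduli lie
      between \<open>E j k\<close> and \<open>exp 1 * E j k\<close>, since the square root of 5 is
      below 5/2.\<close>
    define B :: "nat \<Rightarrow> (complex^'n) set" where
      "B j = cbox (\<chi> k. of_real (E j k)) (\<chi> k. Complex (2 * E j k) (E j k))" for j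
    have bas: "axis k 1 \<in> (Basis :: (complex^'n) set)" "axis k \<i> \<in> (Basis :: (complex^'n) set)" for k
      by (auto simp: Basis_vec_def Basis_complex_def)
    have B_iff: "E j k \<le> Re (z$k) \<and> Re (z$k) \<le> 2 * E j k \<and> 0 \<le> Im (z$k) \<and> Im (z$k) \<le> E j k"
      if "z \<in> B j" for z j k
      using that bas[of k] unfolding B_def mem_box by (metis (no_types, lifting) inner_axis_complex vec_lambda_beta
        Re_complex_of_real Im_complex_of_real complex.sel)
    have cm: "E j k \<le> cmod (z$k)" "cmod (z$k) \<le> exp 1 * E j k" if z: "z \<in> B j" for z j k
    proof -
      show "E j k \<le> cmod (z$k)" using B_iff[OF z, of k] complex_Re_le_cmod[of "z$k"] by linarith
      have "(cmod (z$k))\<^sup>2 = (Re (z$k))\<^sup>2 + (Im (z$k))\<^sup>2" by (rule cmod_power2)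
      also have "\<dots> \<le> (2 * E j k)\<^sup>2 + (E j k)\<^sup>2"
        using B_iff[OF z, of k] E[of j k] by (intro add_mono power_mono) auto
      also have "\<dots> \<le> (5/2 * E j k)\<^sup>2" by (simp add: power_mult_distrib power2_eq_square)
      finally have "cmod (z$k) \<le> 5/2 * E j k" using E[of j k] by (simp add: power2_le_iff_abs_le)
      also have "\<dots> \<le> exp 1 * E j k"
        using exp_lower_Taylor_quadratic[of 1] E[of j k] by (intro mult_right_mono) (auto simp: less_imp_le)
      finally show "cmod (z$k) \<le> exp 1 * E j k" .
    qed
    \<comment> \<open>On a box \<open>logmod z\<close> differs from \<open>j \<tau>\<close> by a
      vector \<open>s\<close> with entries in [0, 1], so \<open>\<psi> s\<close> is at most
      \<open>K * CARD('n)\<close>.\<close>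
    define c0 where "c0 = exp (- 2 * \<phi> 0 - 2 * (K * real CARD('n)))"
    have wt: "weight (monom J) z \<ge> c0 * exp (- 2 * real j * (\<Sum>k\<in>UNIV. \<tau>$k))" if z: "z \<in> B j" and j: "j > 0" for z j
    proof -
      have nz: "z$k \<noteq> 0" for k using cm(1)[OF z, of k] E[of j k] by auto
      define s where "s = logmod z - real j *\<^sub>R \<tau>"
      have s: "0 \<le> s$k" "s$k \<le> 1" for k
      proof -
        have "ln (E j k) \<le> ln (cmod (z$k))" using cm(1)[OF z, of k] E[of j k] by (intro ln_mono) auto
        then show "0 \<le> s$k" by (simp add: s_def logmod_def E_def)
        have "ln (cmod (z$k)) \<le> ln (exp 1 * E j k)" using cm(2)[OF z, of k] nz[of k] E[of j k] by (intro ln_mono) auto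
        then show "s$k \<le> 1" by (simp add: s_def logmod_def E_def ln_mult)
      qed
      have "norm s \<le> (\<Sum>k\<in>UNIV. \<bar>s$k\<bar>)" by (rule norm_le_l1_cart)
      also have "\<dots> \<le> (\<Sum>k\<in>(UNIV::'n set). 1)" using s by (intro sum_mono) (simp add: abs_le_iff)
      finally have "norm s \<le> real CARD('n)" by simp
      then have "\<psi> s \<le> K * real CARD('n)"
        using psi_le[of s] mult_left_mono[OF _ K_nonneg] order_trans by blast
      moreover have lz: "logmod z = real j *\<^sub>R \<tau> + s" by (simp add: s_def)
      moreover have "\<phi> (real j *\<^sub>R \<tau> + s) \<le> \<phi> 0 + real j * \<psi> \<tau> + \<psi> s"
        using phi_add_le[of "real j *\<^sub>R \<tau>" s] phi_add_le[of 0 "real j *\<^sub>R \<tau>"] psi_scale[of "real j" \<tau>] j by simp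
      moreover have "real j * \<psi> \<tau> \<le> real j * (?a \<bullet> \<tau>)" using a_tau by (intro mult_left_mono) auto
      ultimately have "\<phi> (logmod z) \<le> \<phi> 0 + real j * (?a \<bullet> \<tau>) + K * real CARD('n)" by simp
      moreover have "(\<chi> k. real (J$k)) \<bullet> logmod z \<ge> real j * ((\<chi> k. real (J$k)) \<bullet> \<tau>)"
      proof -
        have "(\<chi> k. real (J$k)) \<bullet> s \<ge> 0" unfolding inner_vec_def using s by (intro sum_nonneg) auto
        then show ?thesis unfolding lz by (simp add: inner_add_right)
      qed
      moreover have "?a \<bullet> \<tau> = (\<chi> k. real (J$k)) \<bullet> \<tau> + (\<Sum>k\<in>UNIV. \<tau>$k)"
        by (simp add: inner_vec_def distrib_right sum.distrib)
      ultimately have "(- 2 * \<phi> 0 - 2 * (K * real CARD('n))) + (- 2 * real j * (\<Sum>k\<in>UNIV. \<tau>$k))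
          \<le> 2 * ((\<chi> k. real (J$k)) \<bullet> logmod z) - 2 * \<phi> (logmod z)"
        by (simp add: distrib_left)
      then have "exp (- 2 * \<phi> 0 - 2 * (K * real CARD('n))) * exp (- 2 * real j * (\<Sum>k\<in>UNIV. \<tau>$k))
          \<le> exp (2 * ((\<chi> k. real (J$k)) \<bullet> logmod z) - 2 * \<phi> (logmod z))"
        unfolding exp_add[symmetric] by simp
      also have "\<dots> = weight (monom J) z"
        using nz by (simp add: weight_def cmod_monom_eq_exp exp_diff exp_minus divide_inverse flip: exp_double)
      finally show ?thesis by (simp add: c0_def)
    qed
    have meas: "emeasure lborel (B j) = ennreal (exp (2 * real j * (\<Sum>k\<in>UNIV. \<tau>$k)))" for j
    proof -
      have "emeasure lborel (B j) = ennreal (\<Prod>b\<in>Basis. ((\<chi> k. Complex (2 * E j k) (E j k)) - (\<chi> k. of_real (E j k))) \<bullet> (b :: complex^'n))"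
        unfolding B_def
      proof (rule emeasure_lborel_cbox)
        fix b :: "complex^'n" assume "b \<in> Basis"
        then obtain k where "b = axis k 1 \<or> b = axis k \<i>" by (auto simp: Basis_vec_def Basis_complex_def)
        then show "(\<chi> k. of_real (E j k)) \<bullet> b \<le> (\<chi> k. Complex (2 * E j k) (E j k)) \<bullet> b"
          using E[of j k] by (auto simp: inner_axis_complex)
      qed
      also have "(\<Prod>b\<in>Basis. ((\<chi> k. Complex (2 * E j k) (E j k)) - (\<chi> k. of_real (E j k))) \<bullet> (b :: complex^'n))
          = (\<Prod>k\<in>UNIV. E j k * E j k)"
        by (simp add: prod_Basis_complex_vec inner_axis_complex)
      also have "\<dots> = exp (2 * real j * (\<Sum>k\<in>UNIV. \<tau>$k))"
        by (simp add: E_def exp_add[symmetric] exp_sum[symmetric] sum_distrib_left mult.assoc)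
      finally show ?thesis .
    qed
    \<comment> \<open>Beyond \<open>j0\<close> the boxes avoid the ball of radius \<rho>; the added
      1 also gives \<open>j > 0\<close>, which \<open>psi_scale\<close> requires.\<close>
    define j0 where "j0 = nat \<lceil>\<bar>\<rho>\<bar>\<rceil> + 1"
    define N where "N = density lborel (\<lambda>z. ennreal (weight (monom J) z) * indicator {z. norm z > \<rho>} z)"
    have [measurable]: "monom J \<in> borel_measurable borel"
      by (intro borel_measurable_continuous_onI continuous_intros)
    have [measurable]: "B j \<in> sets borel" for j by (simp add: B_def)
    have NB: "emeasure N (B j) \<ge> ennreal c0" if j: "j \<ge> j0" for j
    proof -
      have big: "norm z > \<rho>" if z: "z \<in> B j" for z
      proof -
        have "\<rho> < real j0" unfolding j0_def by linarith
        also have "\<dots> \<le> 1 + real j * 2" using j by simp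
        also have "\<dots> \<le> E j k0" using exp_ge_add_one_self[of "real j * 2"] by (simp add: E_def tau0)
        also have "\<dots> \<le> cmod (z$k0)" by (rule cm[OF z])
        also have "\<dots> \<le> norm z" by (rule Finite_Cartesian_Product.norm_nth_le)
        finally show ?thesis .
      qed
      have "ennreal c0 = ennreal (c0 * exp (- 2 * real j * (\<Sum>k\<in>UNIV. \<tau>$k))) * emeasure lborel (B j)"
        unfolding meas by (simp add: ennreal_mult''[symmetric] exp_minus mult.assoc[of c0])
      also have "\<dots> = (\<integral>\<^sup>+z. ennreal (c0 * exp (- 2 * real j * (\<Sum>k\<in>UNIV. \<tau>$k))) * indicator (B j) z \<partial>lborel)"
        by (simp add: nn_integral_cmult_indicator)
      also have "\<dots> \<le> (\<integral>\<^sup>+z. ennreal (weight (monom J) z) * indicator {z. norm z > \<rho>} z * indicator (B j) z \<partial>lborel)"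
      proof (intro nn_integral_mono)
        fix z :: "complex^'n"
        have "j > 0" using j by (simp add: j0_def)
        then show "ennreal (c0 * exp (- 2 * real j * (\<Sum>k\<in>UNIV. \<tau>$k))) * indicator (B j) z
            \<le> ennreal (weight (monom J) z) * indicator {z. norm z > \<rho>} z * indicator (B j) z"
          using wt[of z j] big[of z] by (auto simp: indicator_def intro: ennreal_leI)
      qed
      also have "\<dots> = emeasure N (B j)" by (simp add: N_def emeasure_density)
      finally show ?thesis .
    qed
    have disj: "disjoint_family (\<lambda>i. B (j0 + i))"
    proof -
      have "B i \<inter> B j = {}" if "i < j" for i j
      proof (rule ccontr)
        assume "B i \<inter> B j \<noteq> {}"
        then obtain z where z: "z \<in> B i" "z \<in> B j" by blast
        have "exp (real j * 2) \<le> exp (1 + real i * 2)"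
          using cm(1)[OF z(2), of k0] cm(2)[OF z(1), of k0] by (simp add: E_def tau0 exp_add)
        then show False using that by simp
      qed
      then show ?thesis unfolding disjoint_family_on_def by (metis Int_commute add_left_cancel linorder_neqE_nat)
    qed
    have "of_nat m * ennreal c0 \<le> tail_norm \<rho> (monom J)" for m
    proof -
      have "of_nat m * ennreal c0 = (\<Sum>i<m. ennreal c0)" by simp
      also have "\<dots> \<le> (\<Sum>i<m. emeasure N (B (j0 + i)))" by (intro sum_mono NB) simp
      also have "\<dots> \<le> (\<Sum>i. emeasure N (B (j0 + i)))" by (intro sum_le_suminf) auto
      also have "\<dots> = emeasure N (\<Union>i. B (j0 + i))"
        using disj by (intro suminf_emeasure) (auto simp: N_def)
      also have "\<dots> \<le> emeasure N UNIV" by (intro emeasure_mono) (auto simp: N_def)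
      also have "\<dots> = tail_norm \<rho> (monom J)" by (simp add: N_def emeasure_density tail_norm_def)
      finally show ?thesis .
    qed
    moreover obtain x where x: "tail_norm \<rho> (monom J) = ennreal x" "x \<ge> 0"
      using fin by (cases "tail_norm \<rho> (monom J)") auto
    moreover have c0: "c0 > 0" by (simp add: c0_def)
    ultimately have "real m * c0 \<le> x" for m
      by (metis ennreal_le_iff ennreal_mult'' ennreal_of_nat_eq_real_of_nat less_imp_le)
    then show False using reals_Archimedean3[OF c0] by (meson not_less)
  qed
qed

theorem P_inf_eq_monom_span:
  assumes v: "\<And>z. (\<forall>k. z$k \<noteq> 0) \<Longrightarrow> v z = ereal (\<phi> (logmod z))"
  shows "P_inf v = monom_span {J. \<forall>t. t \<noteq> 0 \<longrightarrow> (\<chi> k. real (J$k) + 1) \<bullet> t < max (\<psi> t) 0}"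
    (is "_ = monom_span ?S")
proof -
  have "P_inf v = tail_polys" using P_inf_eq[OF v] by (simp add: tail_polys_def)
  also have "tail_polys = monom_span ?S"
  proof (intro equalityI subsetI)
    fix P assume P: "P \<in> tail_polys"
    then obtain F c where F: "finite F" "P = (\<lambda>z. \<Sum>J\<in>F. c J * monom J z)"
      by (auto simp: tail_polys_def polys_def monom_span_def)
    \<comment> \<open>The representation may carry zero coefficients, whose exponents are
      unrestricted; they are dropped below.\<close>
    have "J \<in> ?S" if J: "J \<in> F" "c J \<noteq> 0" for J
    proof -
      have "(\<lambda>z. c J * monom J z) \<in> tail_polys"
        by (rule monomial_terms_in_dilation_invariant_space[where F = F])
           (use tail_polys_add tail_polys_cmult tail_polys_dilate F P J in auto)
      then have "(\<lambda>z. inverse (c J) * (c J * monom J z)) \<in> tail_polys" by (rule tail_polys_cmult)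
      then have "monom J \<in> tail_polys" using J by (simp add: mult.assoc[symmetric])
      then show ?thesis using monom_tail_finite_imp by (auto simp: tail_polys_def)
    qed
    moreover have "P z = (\<Sum>J\<in>{J\<in>F. c J \<noteq> 0}. c J * monom J z)" for z
      unfolding F(2) using F(1) by (intro sum.mono_neutral_right) auto
    ultimately show "P \<in> monom_span ?S"
      using F(1) by (intro monom_spanI[where F = "{J\<in>F. c J \<noteq> 0}" and c = c]) auto
  next
    fix P assume "P \<in> monom_span ?S"
    then obtain F c where F: "finite F" "F \<subseteq> ?S" "P = (\<lambda>z. \<Sum>J\<in>F. c J * monom J z)"
      by (auto simp: monom_span_def)
    have "(\<lambda>z. \<Sum>J\<in>F. c J * monom J z) \<in> tail_polys"
      using F(1,2)
    proof (induction F rule: finite_induct)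
      case empty
      have "tail_norm 0 (\<lambda>z. 0) = 0" by (simp add: tail_norm_def weight_def)
      moreover have "(\<lambda>z. 0) \<in> polys" unfolding polys_def by (rule monom_spanI[where F = "{}"]) auto
      ultimately have "(\<lambda>z. 0) \<in> tail_polys" by (auto simp: tail_polys_def intro!: exI[of _ 0])
      then show ?case by simp
    next
      case (insert J F)
      have "tail_norm (real CARD('n)) (monom J) < \<infinity>" using insert.prems by (intro monom_tail_finite) auto
      moreover have "monom J \<in> polys" using monom_in_monom_span[of J UNIV 1] by (simp add: polys_def)
      ultimately have "monom J \<in> tail_polys" unfolding tail_polys_def by blast
      then have "(\<lambda>z. c J * monom J z) \<in> tail_polys" by (rule tail_polys_cmult)
      then have "(\<lambda>z. c J * monom J z + (\<Sum>J\<in>F. c J * monom J z)) \<in> tail_polys"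
        using insert by (intro tail_polys_add) auto
      then show ?case using insert by simp
    qed
    then show "P \<in> tail_polys" using F by simp
  qed
  finally show ?thesis .
qed

end

section \<open>Recession functions\<close>

text \<open>The recession function of convex analysis. For convex \<phi> the slopes increase with
  \<open>R\<close>, so the supremum is a limit; starting at 1 keeps the constant of the growth bound
  divided by \<open>R\<close> bounded.\<close>

definition recession :: "(real^'n \<Rightarrow> real) \<Rightarrow> real^'n \<Rightarrow> real" where
  "recession \<phi> t = (SUP R\<in>{1..}. (\<phi> (R *\<^sub>R t) - \<phi> 0) / R)"

locale linear_growth_convex =
  fixes \<phi> :: "real^'n \<Rightarrow> real" and K W :: real
  assumes conv: "convex_on UNIV \<phi>"
    and growth: "\<phi> t \<le> W + K * norm t"
    and K_nonneg: "K \<ge> 0"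
    and ray_nonneg: "t$k > 0 \<Longrightarrow> \<forall>\<^sub>F R in at_top. \<phi> (R *\<^sub>R t) \<ge> 0"
begin

lemma slope_mono:
  assumes "0 < R" "R \<le> R'"
  shows "(\<phi> (R *\<^sub>R t) - \<phi> 0) / R \<le> (\<phi> (R' *\<^sub>R t) - \<phi> 0) / R'"
proof -
  have "\<phi> ((1 - R/R') *\<^sub>R 0 + (R/R') *\<^sub>R (R' *\<^sub>R t)) \<le> (1 - R/R') * \<phi> 0 + (R/R') * \<phi> (R' *\<^sub>R t)"
    using assms by (intro convex_onD[OF conv]) auto
  then have "\<phi> (R *\<^sub>R t) \<le> (1 - R/R') * \<phi> 0 + (R/R') * \<phi> (R' *\<^sub>R t)" using assms by simp
  then have "(\<phi> (R *\<^sub>R t) - \<phi> 0) / R \<le> ((1 - R/R') * \<phi> 0 + (R/R') * \<phi> (R' *\<^sub>R t) - \<phi> 0) / R"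
    using assms by (intro divide_right_mono) auto
  also have "\<dots> = (\<phi> (R' *\<^sub>R t) - \<phi> 0) / R'" using assms by (simp add: field_simps)
  finally show ?thesis .
qed

lemma recession_tendsto: "((\<lambda>R. \<phi> (R *\<^sub>R t) / R) \<longlongrightarrow> recession \<phi> t) at_top"
proof -
  let ?m = "\<lambda>R. (\<phi> (R *\<^sub>R t) - \<phi> 0) / R"
  have "?m R \<le> \<bar>W - \<phi> 0\<bar> + K * norm t" if "R \<ge> 1" for R
  proof -
    have "?m R \<le> (\<bar>W - \<phi> 0\<bar> + K * (R * norm t)) / R"
      using growth[of "R *\<^sub>R t"] that by (intro divide_right_mono) auto
    also have "\<dots> = \<bar>W - \<phi> 0\<bar> / R + K * norm t" using that by (simp add: field_simps)
    also have "\<bar>W - \<phi> 0\<bar> / R \<le> \<bar>W - \<phi> 0\<bar> / 1" using that by (intro divide_left_mono) auto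
    finally show ?thesis by simp
  qed
  then have bdd: "bdd_above (?m ` {1..})" by (intro bdd_aboveI2) auto
  have lim: "(?m \<longlongrightarrow> recession \<phi> t) at_top"
  proof (rule increasing_tendsto)
    show "\<forall>\<^sub>F R in at_top. ?m R \<le> recession \<phi> t"
      using eventually_ge_at_top[of 1]
      by eventually_elim (auto simp: recession_def intro!: cSUP_upper[OF _ bdd])
  next
    fix x assume "x < recession \<phi> t"
    then obtain R0 where R0: "R0 \<ge> 1" "x < ?m R0"
      using less_cSUP_iff[OF _ bdd, of x] by (auto simp: recession_def)
    show "\<forall>\<^sub>F R in at_top. x < ?m R"
      using eventually_ge_at_top[of R0]
      by eventually_elim (use slope_mono[of R0 _ t] R0 in \<open>auto intro: less_le_trans\<close>)
  qed
  have "((\<lambda>R. ?m R + \<phi> 0 / R) \<longlongrightarrow> recession \<phi> t + 0) at_top"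
    by (intro tendsto_add lim tendsto_divide_0[OF tendsto_const] filterlim_at_top_imp_at_infinity filterlim_ident)
  then show ?thesis by (simp add: diff_divide_distrib)
qed

text \<open>Write \<open>t + s\<close> as the convex combination of \<open>t / (1 - 1/R)\<close> and
  \<open>R s\<close> with weights \<open>1 - 1/R\<close> and \<open>1/R\<close>, and let
  \<open>R\<close> tend to infinity; \<phi> is continuous at \<open>t\<close>.\<close>

lemma phi_add_le_recession: "\<phi> (t + s) \<le> \<phi> t + recession \<phi> s"
proof -
  have cont: "isCont \<phi> t"
    using convex_on_continuous[OF open_UNIV conv] by (simp add: continuous_on_eq_continuous_at)
  have inv: "((\<lambda>R::real. 1 / R) \<longlongrightarrow> 0) at_top"
    by (intro tendsto_divide_0[OF tendsto_const] filterlim_at_top_imp_at_infinity filterlim_ident)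
  have "((\<lambda>R. (1 / (1 - 1/R)) *\<^sub>R t) \<longlongrightarrow> (1 / (1 - 0)) *\<^sub>R t) at_top"
    by (intro tendsto_intros inv) auto
  then have "((\<lambda>R. \<phi> ((1 / (1 - 1/R)) *\<^sub>R t)) \<longlongrightarrow> \<phi> t) at_top"
    using isCont_tendsto_compose[OF cont] by simp
  then have "((\<lambda>R. (1 - 1/R) * \<phi> ((1 / (1 - 1/R)) *\<^sub>R t) + \<phi> (R *\<^sub>R s) / R) \<longlongrightarrow> (1 - 0) * \<phi> t + recession \<phi> s) at_top"
    by (intro tendsto_intros inv recession_tendsto)
  moreover have "\<forall>\<^sub>F R in at_top. \<phi> (t + s) \<le> (1 - 1/R) * \<phi> ((1 / (1 - 1/R)) *\<^sub>R t) + \<phi> (R *\<^sub>R s) / R"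
    using eventually_gt_at_top[of 1]
  proof eventually_elim
    case (elim R)
    have "\<phi> ((1 - 1/R) *\<^sub>R ((1 / (1 - 1/R)) *\<^sub>R t) + (1/R) *\<^sub>R (R *\<^sub>R s))
        \<le> (1 - 1/R) * \<phi> ((1 / (1 - 1/R)) *\<^sub>R t) + (1/R) * \<phi> (R *\<^sub>R s)"
      using elim by (intro convex_onD[OF conv]) auto
    then show ?case using elim by simp
  qed
  ultimately show ?thesis using tendsto_lowerbound by fastforce
qed

lemma recession_scale:
  assumes "c > 0" shows "recession \<phi> (c *\<^sub>R t) = c * recession \<phi> t"
proof -
  have "filterlim (\<lambda>R::real. c * R) at_top at_top"
    by (rule filterlim_tendsto_pos_mult_at_top[OF tendsto_const assms filterlim_ident])
  from filterlim_compose[OF recession_tendsto this]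
  have "((\<lambda>R. c * (\<phi> ((c * R) *\<^sub>R t) / (c * R))) \<longlongrightarrow> c * recession \<phi> t) at_top"
    by (intro tendsto_mult_left)
  then have "((\<lambda>R. \<phi> (R *\<^sub>R (c *\<^sub>R t)) / R) \<longlongrightarrow> c * recession \<phi> t) at_top"
    using assms by (simp add: mult.commute)
  then show ?thesis using recession_tendsto[of "c *\<^sub>R t"] tendsto_unique by (metis trivial_limit_at_top_linorder)
qed

lemma recession_add_le: "recession \<phi> (t + s) \<le> recession \<phi> t + recession \<phi> s"
proof (rule tendsto_le[OF _ tendsto_add[OF recession_tendsto tendsto_const] recession_tendsto])
  show "\<forall>\<^sub>F R in at_top. \<phi> (R *\<^sub>R (t + s)) / R \<le> \<phi> (R *\<^sub>R t) / R + recession \<phi> s"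
    using eventually_gt_at_top[of 0]
  proof eventually_elim
    case (elim R)
    have "\<phi> (R *\<^sub>R t + R *\<^sub>R s) \<le> \<phi> (R *\<^sub>R t) + R * recession \<phi> s"
      using phi_add_le_recession[of "R *\<^sub>R t" "R *\<^sub>R s"] elim by (simp add: recession_scale)
    then show ?case using elim by (simp add: field_simps scaleR_add_right)
  qed
qed simp

lemma recession_le_of_ray_bound:
  assumes "\<forall>\<^sub>F R in at_top. \<phi> (R *\<^sub>R t) \<le> B + R * L"
  shows "recession \<phi> t \<le> L"
proof (rule tendsto_le[OF _ _ recession_tendsto])
  have "((\<lambda>R::real. B / R + L) \<longlongrightarrow> 0 + L) at_top"
    by (intro tendsto_intros tendsto_divide_0[OF tendsto_const] filterlim_at_top_imp_at_infinity filterlim_ident)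
  then show "((\<lambda>R::real. B / R + L) \<longlongrightarrow> L) at_top" by simp
  show "\<forall>\<^sub>F R in at_top. \<phi> (R *\<^sub>R t) / R \<le> B / R + L"
    using assms eventually_gt_at_top[of 0]
  proof eventually_elim
    case (elim R)
    then have "\<phi> (R *\<^sub>R t) / R \<le> (B + R * L) / R" by (intro divide_right_mono) auto
    then show ?case using elim by (simp add: add_divide_distrib)
  qed
qed simp

lemma recession_le: "recession \<phi> t \<le> K * norm t"
proof (rule recession_le_of_ray_bound)
  show "\<forall>\<^sub>F R in at_top. \<phi> (R *\<^sub>R t) \<le> W + R * (K * norm t)"
    using eventually_gt_at_top[of 0]
  proof eventually_elim
    case (elim R)
    then show ?case using growth[of "R *\<^sub>R t"] by (simp add: mult.left_commute)
  qed
qed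

lemma recession_nonneg: "recession \<phi> t \<ge> 0" if "t$k > 0" for t :: "real^'n"
proof (rule tendsto_lowerbound[OF recession_tendsto])
  show "\<forall>\<^sub>F R in at_top. 0 \<le> \<phi> (R *\<^sub>R t) / R"
    using ray_nonneg[OF that] eventually_gt_at_top[of 0] by eventually_elim auto
qed simp

text \<open>The slopes converge uniformly on the sphere, because they are uniformly Lipschitz.\<close>
lemma phi_ge_recession:
  assumes "\<epsilon> > 0"
  shows "\<exists>C. \<forall>t. recession \<phi> t - \<epsilon> * norm t - C \<le> \<phi> t"
proof -
  have phi_lip: "\<phi> t - \<phi> s \<le> K * norm (t - s)" for t s
    using phi_add_le_recession[of s "t - s"] recession_le[of "t - s"] by simp
  have rec_lip: "recession \<phi> t - recession \<phi> s \<le> K * norm (t - s)" for t s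
    using recession_add_le[of s "t - s"] recession_le[of "t - s"] by simp
  \<comment> \<open>Passing from a direction to a nearby net point costs \<open>K \<eta>\<close> per
    unit length, once for \<phi> and once for its recession function, together at most \<epsilon>/2.
    The other half pays for convergence at the net points. The summand 4 covers
    \<open>K = 0\<close>.\<close>
  define \<eta> where "\<eta> = \<epsilon> / (4 * K + 4)"
  have eta: "\<eta> > 0" using assms K_nonneg by (simp add: \<eta>_def)
  have Keta: "2 * (K * \<eta>) \<le> \<epsilon> / 2" using assms K_nonneg by (simp add: \<eta>_def field_simps)
  obtain Y where Y: "finite Y" "sphere (0::real^'n) 1 \<subseteq> (\<Union>y\<in>Y. ball y \<eta>)"
    using compact_sphere[of "0::real^'n" 1] eta unfolding compact_eq_totally_bounded by blast
  have "\<forall>\<^sub>F R in at_top. \<forall>y\<in>Y. recession \<phi> y - \<epsilon>/2 < \<phi> (R *\<^sub>R y) / R"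
    using assms by (intro eventually_ball_finite Y(1) ballI order_tendstoD(1)[OF recession_tendsto]) simp
  then obtain R1 where R1: "\<And>R y. R \<ge> R1 \<Longrightarrow> y \<in> Y \<Longrightarrow> recession \<phi> y - \<epsilon>/2 < \<phi> (R *\<^sub>R y) / R"
    unfolding eventually_at_top_linorder by blast
  define R0 where "R0 = max R1 1"
  have "recession \<phi> t - \<epsilon> * norm t - (2 * (K * R0) + \<bar>\<phi> 0\<bar>) \<le> \<phi> t" for t
  proof (cases "norm t < R0")
    case True
    then have "K * norm t \<le> K * R0" using K_nonneg by (intro mult_left_mono) auto
    moreover have "\<epsilon> * norm t \<ge> 0" using assms by simp
    ultimately show ?thesis using recession_le[of t] phi_lip[of 0 t] by auto
  next
    case False
    define R where "R = norm t"
    have R: "R \<ge> R1" "R > 0" "K * R0 \<ge> 0" using False K_nonneg by (auto simp: R_def R0_def)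
    define w where "w = inverse R *\<^sub>R t"
    have t: "t = R *\<^sub>R w" using R by (simp add: w_def)
    have "w \<in> sphere 0 1" using R by (simp add: w_def R_def)
    then obtain y where y: "y \<in> Y" "norm (y - w) \<le> \<eta>" using Y(2) by (force simp: dist_norm)
    have Ry: "K * norm (R *\<^sub>R y - R *\<^sub>R w) \<le> K * (R * \<eta>)"
      using y R K_nonneg by (simp flip: scaleR_diff_right add: mult_left_mono)
    have 1: "\<phi> (R *\<^sub>R y) \<le> \<phi> t + K * (R * \<eta>)"
      using phi_lip[of "R *\<^sub>R y" "R *\<^sub>R w"] Ry unfolding t by simp
    have 2: "recession \<phi> t \<le> R * recession \<phi> y + K * (R * \<eta>)"
      using rec_lip[of "R *\<^sub>R w" "R *\<^sub>R y"] Ry R unfolding t by (simp add: recession_scale norm_minus_commute)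
    have 3: "R * (recession \<phi> y - \<epsilon>/2) \<le> \<phi> (R *\<^sub>R y)"
      using R1[OF R(1) y(1)] R by (simp add: field_simps)
    have "R * (2 * (K * \<eta>)) \<le> R * (\<epsilon> / 2)" using Keta R by (intro mult_left_mono) auto
    then have "recession \<phi> t - \<epsilon> * R \<le> \<phi> t" using 1 2 3 by (simp add: algebra_simps)
    then show ?thesis using R by (simp add: R_def)
  qed
  then show ?thesis by blast
qed

lemma toric_weight_recession: "toric_weight \<phi> (recession \<phi>) K"
  by unfold_locales
     (use phi_add_le_recession phi_ge_recession recession_le K_nonneg recession_scale recession_add_le recession_nonneg in auto)

lemma toric_weight_recession_self: "toric_weight (recession \<phi>) (recession \<phi>) K"
proof unfold_locales
  show "\<exists>C. \<forall>t. recession \<phi> t - \<epsilon> * norm t - C \<le> recession \<phi> t" if "\<epsilon> > 0" for \<epsilon>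
    using that by (intro exI[of _ 0]) simp
qed (use recession_le K_nonneg recession_scale recession_add_le recession_nonneg in auto)

end

text \<open>A ball of radius \<open>e\<close> around \<open>a\<close> raises the support value in
  direction \<open>t\<close> by \<open>e * norm t\<close>; conversely \<open>support_gap\<close>
  provides such a radius.\<close>

lemma (in toric_weight) interior_support_set:
  "interior {a. \<forall>t. a \<bullet> t \<le> max (\<psi> t) 0} = {a. \<forall>t. t \<noteq> 0 \<longrightarrow> a \<bullet> t < max (\<psi> t) 0}"
    (is "interior ?G = ?S")
proof (intro equalityI subsetI)
  fix a assume "a \<in> interior ?G"
  then obtain e where e: "e > 0" "cball a e \<subseteq> ?G" by (auto simp: mem_interior_cball)
  have "a \<bullet> t < max (\<psi> t) 0" if "t \<noteq> 0" for t
  proof -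
    have "a + (e / norm t) *\<^sub>R t \<in> ?G" using e that by (intro subsetD[OF e(2)]) (simp add: dist_norm)
    then have "a \<bullet> t + e / norm t * (t \<bullet> t) \<le> max (\<psi> t) 0" by (simp add: inner_add_left)
    moreover have "e / norm t * (t \<bullet> t) > 0" using e that by simp
    ultimately show ?thesis by linarith
  qed
  then show "a \<in> ?S" by simp
next
  fix a assume "a \<in> ?S"
  then obtain \<delta> where d: "\<delta> > 0" "\<And>t. a \<bullet> t + \<delta> * norm t \<le> max (\<psi> t) 0"
    using support_gap[of a] by auto
  have "ball a \<delta> \<subseteq> ?G"
  proof
    fix b assume "b \<in> ball a \<delta>"
    then have b: "norm (b - a) \<le> \<delta>" by (simp add: dist_norm norm_minus_commute)
    have "b \<bullet> t \<le> max (\<psi> t) 0" for t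
    proof -
      have "(b - a) \<bullet> t \<le> norm (b - a) * norm t" by (rule norm_cauchy_schwarz)
      also have "\<dots> \<le> \<delta> * norm t" using b by (intro mult_right_mono) auto
      finally show ?thesis using d(2)[of t] by (simp add: inner_diff_left)
    qed
    then show "b \<in> ?G" by simp
  qed
  then show "a \<in> interior ?G" using d(1) by (meson centre_in_ball interior_maximal open_ball subsetD)
qed

section \<open>Toric plurisubharmonic functions\<close>

definition expvec :: "real^'n \<Rightarrow> complex^'n" where
  "expvec t = (\<chi> k. complex_of_real (exp (t$k)))"

lemma logmod_expvec [simp]: "logmod (expvec t) = t"
  by (simp add: logmod_def expvec_def vec_eq_iff)

lemma continuous_on_expvec: "continuous_on S expvec"
  unfolding expvec_def by (intro continuous_intros)

lemma norm_expvec_ge: "exp (t$k) \<le> norm (expvec t)"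
  using Finite_Cartesian_Product.norm_nth_le[of "expvec t" k] by (simp add: expvec_def)

lemma norm_expvec_le:
  fixes t :: "real^'n"
  assumes "\<And>k. t$k \<le> B"
  shows "norm (expvec t) \<le> real CARD('n) * exp B"
proof -
  have "norm (expvec t) \<le> (\<Sum>k\<in>UNIV. norm (expvec t $ k))"
    unfolding norm_vec_def by (rule L2_set_le_sum) simp
  also have "\<dots> \<le> (\<Sum>k\<in>(UNIV::'n set). exp B)"
    using assms by (intro sum_mono) (simp add: expvec_def)
  finally show ?thesis by simp
qed

locale toric_LPSH_star =
  fixes u :: "complex^'n \<Rightarrow> ereal"
  assumes star: "LPSH_star u" and tor: "toric u"
begin

lemma psh_u: "psh u" using star by (simp add: LPSH_star_def LPSH_def)

lemma open_less: "open {z. u z < c}" using psh_u by (simp add: psh_def usc_def)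

lemma u_less_top: "u z < \<infinity>" using psh_u by (simp add: psh_def)

lemma u_le_circle_mean: "r > 0 \<Longrightarrow> u a \<le> circle_mean u a b r"
  using psh_u by (simp add: psh_def)

lemma toricD: "(\<And>k. cmod (z$k) = cmod (w$k)) \<Longrightarrow> u z = u w"
  using tor by (simp add: toric_def)

lemma bounded_above_on_cball:
  assumes "\<rho> \<ge> 0"
  shows "\<exists>B. \<forall>z. norm z \<le> \<rho> \<longrightarrow> u z \<le> ereal B"
proof -
  obtain m where "\<forall>z\<in>cball 0 \<rho>. u z \<le> u m"
    using usc_attains_max[OF compact_cball _ open_less, of 0 \<rho>] assms by auto
  then have "\<And>z. norm z \<le> \<rho> \<Longrightarrow> u z \<le> u m" by simp
  moreover obtain B where "u m \<le> ereal B" using u_less_top[of m] by (cases "u m") auto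
  ultimately show ?thesis using order_trans by blast
qed

lemma eventually_gt: "\<exists>\<rho>. \<forall>z. norm z \<ge> \<rho> \<longrightarrow> u z > ereal c"
  using star by (simp add: LPSH_star_def tendsto_PInfty eventually_at_infinity)

lemma convex_ereal:
  assumes "u (expvec p) \<le> ereal a" "u (expvec (p + d)) \<le> ereal b" "0 \<le> x" "x \<le> 1"
  shows "u (expvec (p + x *\<^sub>R d)) \<le> ereal ((1-x) * a + x * b)"
\<comment> \<open>The circle around \<open>expvec t\<close> in the direction with entries
  \<open>exp (t$k) * d$k\<close> has coordinates
  \<open>exp (t$k) * (1 + r d_k exp (\<i> \<theta>))\<close>, so its logarithmic displacement is
  exactly the one in the convexity criterion.\<close>
proof (rule log_circle_submean_imp_convex[where f = "\<lambda>t. u (expvec t)", OF _ u_less_top _ assms])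
  show "open {t. u (expvec t) < c}" for c
    using open_vimage[OF open_less continuous_on_expvec[of UNIV], of c] by (simp add: vimage_def)
next
  fix t :: "real^'n" and r :: real and G
  assume r: "r > 0" and rd: "\<forall>k. \<bar>r * d$k\<bar> < 1" and G: "continuous_on {0..2*pi} G"
    and le: "\<And>\<theta>. u (expvec (t + (\<chi> k. ln (cmod (1 + of_real (r * d$k) * exp (\<i> * of_real \<theta>)))))) \<le> ereal (G \<theta>)"
  define b where "b = (\<chi> k. complex_of_real (exp (t$k) * d$k))"
  have "u (expvec t + (of_real r * exp (\<i> * of_real \<theta>)) *s b) \<le> ereal (G \<theta>)" for \<theta>
  proof -
    have "u (expvec t + (of_real r * exp (\<i> * of_real \<theta>)) *s b)
        = u (expvec (t + (\<chi> k. ln (cmod (1 + of_real (r * d$k) * exp (\<i> * of_real \<theta>))))))"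
    proof (rule toricD)
      fix k
      let ?w = "of_real (r * d$k) * exp (\<i> * of_real \<theta>) :: complex"
      have "cmod ?w < 1" using rd by (simp add: norm_mult abs_mult)
      then have nz: "1 + ?w \<noteq> 0" by (metis add.inverse_unique less_irrefl norm_minus_cancel norm_one)
      have "(expvec t + (of_real r * exp (\<i> * of_real \<theta>)) *s b) $ k = of_real (exp (t$k)) * (1 + ?w)"
        by (simp add: expvec_def b_def algebra_simps)
      then have "cmod ((expvec t + (of_real r * exp (\<i> * of_real \<theta>)) *s b) $ k) = exp (t$k) * cmod (1 + ?w)"
        by (simp add: norm_mult)
      also have "\<dots> = exp (t$k + ln (cmod (1 + ?w)))" using nz by (simp add: exp_add)
      finally show "cmod ((expvec t + (of_real r * exp (\<i> * of_real \<theta>)) *s b) $ k)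
          = cmod (expvec (t + (\<chi> k. ln (cmod (1 + of_real (r * d$k) * exp (\<i> * of_real \<theta>))))) $ k)"
        by (simp add: expvec_def)
    qed
    then show ?thesis using le[of \<theta>] by simp
  qed
  then have "circle_mean u (expvec t) b r \<le> ereal (integral {0..2*pi} G / (2*pi))"
    by (intro circle_mean_le G)
  then show "u (expvec t) \<le> ereal (integral {0..2*pi} G / (2*pi))"
    using u_le_circle_mean[OF r] order_trans by blast
qed

text \<open>Otherwise convexity, with any real bound at \<open>p\<close>, would spread the value
  -infinity. With \<open>t\<close> as midpoint between \<open>p\<close> and \<open>p + d\<close>,
  the bound \<open>- B\<close> at \<open>p\<close> cancels \<open>B\<close> and forces
  \<open>u (expvec t) \<le> 0\<close>, where \<open>u\<close> is positive.\<close>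

lemma u_expvec_finite: "u (expvec p) \<noteq> -\<infinity>"
proof
  assume p: "u (expvec p) = -\<infinity>"
  obtain \<rho> where \<rho>: "\<And>z. norm z \<ge> \<rho> \<Longrightarrow> u z > ereal 0" using eventually_gt[of 0] by blast
  define t :: "real^'n" where "t = (\<chi> k. \<rho>)"
  have "\<rho> \<le> exp \<rho>" using exp_ge_add_one_self[of \<rho>] by linarith
  then have "\<rho> \<le> norm (expvec t)" using norm_expvec_ge[of t undefined] by (simp add: t_def)
  then have t: "u (expvec t) > 0" using \<rho> by (simp add: zero_ereal_def)
  define d where "d = 2 *\<^sub>R (t - p)"
  obtain B where B: "u (expvec (p + d)) \<le> ereal B"
    using u_less_top[of "expvec (p + d)"] by (cases "u (expvec (p + d))") auto
  have "u (expvec (p + (1/2) *\<^sub>R d)) \<le> ereal ((1 - 1/2) * (- B) + 1/2 * B)"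
    by (rule convex_ereal[OF _ B]) (auto simp: p)
  then show False using t by (simp add: d_def zero_ereal_def)
qed

definition \<phi> :: "real^'n \<Rightarrow> real" where "\<phi> t = real_of_ereal (u (expvec t))"

lemma u_expvec: "u (expvec t) = ereal (\<phi> t)"
  using u_expvec_finite[of t] u_less_top[of "expvec t"] by (cases "u (expvec t)") (auto simp: \<phi>_def)

lemma u_torus:
  assumes "\<forall>k. z$k \<noteq> 0"
  shows "u z = ereal (\<phi> (logmod z))"
proof -
  have "u z = u (expvec (logmod z))"
    using assms by (intro toricD) (simp add: expvec_def logmod_def)
  then show ?thesis by (simp add: u_expvec)
qed

lemma convex_phi: "convex_on UNIV \<phi>"
proof (rule convex_onI)
  fix x :: real and p q :: "real^'n"
  assume "0 < x" "x < 1"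
  then have "u (expvec (p + x *\<^sub>R (q - p))) \<le> ereal ((1-x) * \<phi> p + x * \<phi> q)"
    by (intro convex_ereal) (auto simp: u_expvec)
  moreover have "p + x *\<^sub>R (q - p) = (1 - x) *\<^sub>R p + x *\<^sub>R q" by (simp add: algebra_simps)
  ultimately show "\<phi> ((1 - x) *\<^sub>R p + x *\<^sub>R q) \<le> (1-x) * \<phi> p + x * \<phi> q"
    by (simp add: u_expvec)
qed simp

lemma phi_growth: "\<exists>K W. K \<ge> 0 \<and> (\<forall>t. \<phi> t \<le> W + K * norm t)"
proof -
  have "Limsup at_infinity (\<lambda>z. u z / ereal (ln (norm z))) < \<infinity>"
    using star by (simp add: LPSH_star_def LPSH_def)
  then obtain C where "Limsup at_infinity (\<lambda>z. u z / ereal (ln (norm z))) < ereal C"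
    using ereal_dense2 by blast
  then have "\<forall>\<^sub>F z in at_infinity. u z / ereal (ln (norm z)) < ereal C" by (rule Limsup_lessD)
  then obtain \<rho>0 where \<rho>0: "\<And>z. norm z \<ge> \<rho>0 \<Longrightarrow> u z / ereal (ln (norm z)) < ereal C"
    unfolding eventually_at_infinity by blast
  \<comment> \<open>At least 2, so that the logarithm of the norm is positive and the quotient bound
    can be multiplied out. Inside this ball upper semicontinuity bounds \<open>u\<close>.\<close>
  define \<rho> where "\<rho> = max \<rho>0 2"
  have "\<rho> \<ge> 0" by (simp add: \<rho>_def)
  then obtain B where B: "\<And>z. norm z \<le> \<rho> \<Longrightarrow> u z \<le> ereal B"
    using bounded_above_on_cball by blast
  define W where "W = \<bar>B\<bar> + \<bar>C\<bar> * ln (real CARD('n))"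
  have W: "\<bar>C\<bar> * ln (real CARD('n)) \<ge> 0" by (simp add: Suc_leI)
  have "\<phi> t \<le> W + \<bar>C\<bar> * norm t" for t
  proof (cases "norm (expvec t) \<le> \<rho>")
    case True
    then have "\<phi> t \<le> B" using B[of "expvec t"] by (simp add: u_expvec)
    moreover have "\<bar>C\<bar> * norm t \<ge> 0" by simp
    ultimately show ?thesis using W unfolding W_def by linarith
  next
    case False
    let ?l = "ln (norm (expvec t))"
    have gt: "norm (expvec t) > 1" "norm (expvec t) \<ge> \<rho>0" using False by (auto simp: \<rho>_def)
    then have l: "?l > 0" by (simp add: ln_gt_zero)
    have "\<phi> t / ?l < C" using \<rho>0[OF gt(2)] l by (simp add: u_expvec)
    then have "\<phi> t \<le> C * ?l" using l by (simp add: field_simps)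
    also have "\<dots> \<le> \<bar>C\<bar> * ?l" using l by (intro mult_right_mono) auto
    also have "?l \<le> ln (real CARD('n) * exp (norm t))"
      using gt by (intro ln_mono norm_expvec_le) (use component_le_norm_cart[of t] in \<open>auto simp: abs_le_iff\<close>)
    also have "\<dots> = ln (real CARD('n)) + norm t" by (simp add: ln_mult)
    finally show ?thesis by (simp add: W_def distrib_left mult_left_mono)
  qed
  then show ?thesis by (intro exI[of _ "\<bar>C\<bar>"] exI[of _ W]) simp
qed

lemma linear_growth_convex_phi: "\<exists>K W. linear_growth_convex \<phi> K W"
proof -
  obtain K W where KW: "K \<ge> 0" "\<And>t. \<phi> t \<le> W + K * norm t" using phi_growth by blast
  have "\<forall>\<^sub>F R in at_top. \<phi> (R *\<^sub>R t) \<ge> 0" if tk: "t$k > 0" for t :: "real^'n" and k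
  proof -
    obtain \<rho> where \<rho>: "\<And>z. norm z \<ge> \<rho> \<Longrightarrow> u z > ereal 0" using eventually_gt[of 0] by blast
    show ?thesis using eventually_ge_at_top[of "\<rho> / t$k"]
    proof eventually_elim
      case (elim R)
      then have "\<rho> \<le> R * t$k" using tk by (simp add: field_simps)
      also have "\<dots> \<le> exp (R * t$k)" using exp_ge_add_one_self[of "R * t$k"] by linarith
      also have "\<dots> \<le> norm (expvec (R *\<^sub>R t))" using norm_expvec_ge[of "R *\<^sub>R t" k] by simp
      finally show ?case using \<rho>[of "expvec (R *\<^sub>R t)"] by (simp add: u_expvec)
    qed
  qed
  then show ?thesis
    using KW convex_phi by (intro exI[of _ K] exI[of _ W]) (unfold_locales, auto)
qed

text \<open>The growth constants depend on \<open>u\<close> and are known only to exist, so the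
  locale parameters are chosen by \<open>SOME\<close>.\<close>

sublocale linear_growth_convex \<phi> "SOME K. \<exists>W. linear_growth_convex \<phi> K W"
    "SOME W. linear_growth_convex \<phi> (SOME K. \<exists>W. linear_growth_convex \<phi> K W) W"
proof -
  have "\<exists>W. linear_growth_convex \<phi> (SOME K. \<exists>W. linear_growth_convex \<phi> K W) W"
    using linear_growth_convex_phi by (rule someI_ex)
  then show "linear_growth_convex \<phi> (SOME K. \<exists>W. linear_growth_convex \<phi> K W)
      (SOME W. linear_growth_convex \<phi> (SOME K. \<exists>W. linear_growth_convex \<phi> K W) W)"
    by (rule someI_ex)
qed

text \<open>Such rays stay in the closed unit polydisc, where \<open>u\<close> is bounded
  above.\<close>

lemma recession_nonpos:
  assumes "\<And>k. t$k \<le> 0"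
  shows "recession \<phi> t \<le> 0"
proof -
  obtain B where B: "\<And>z. norm z \<le> real CARD('n) \<Longrightarrow> u z \<le> ereal B"
    using bounded_above_on_cball[of "real CARD('n)"] by auto
  have "\<forall>\<^sub>F R in at_top. \<phi> (R *\<^sub>R t) \<le> B + R * 0"
    using eventually_gt_at_top[of 0]
  proof eventually_elim
    case (elim R)
    have "norm (expvec (R *\<^sub>R t)) \<le> real CARD('n) * exp 0"
      using elim assms by (intro norm_expvec_le) (simp add: mult_nonneg_nonpos)
    then show ?case using B[of "expvec (R *\<^sub>R t)"] by (simp add: u_expvec)
  qed
  then show ?thesis by (rule recession_le_of_ray_bound)
qed

text \<open>The maximum principle in logarithmic form: the step \<open>s - t\<close> has nonpositive
  recession value.\<close>

lemma phi_mono: "(\<And>k. s$k \<le> t$k) \<Longrightarrow> \<phi> s \<le> \<phi> t"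
  using phi_add_le_recession[of t "s - t"] recession_nonpos[of "s - t"] by simp

text \<open>Vanishing coordinates of \<open>\<zeta>\<close> are reached by one circle mean whose circle lies in a torus orbit.\<close>
lemma u_le_phi:
  assumes "\<And>k. cmod (\<zeta>$k) \<le> exp (t$k)"
  shows "u \<zeta> \<le> ereal (\<phi> t)"
proof -
  \<comment> \<open>Only the vanishing coordinates are moved, each to modulus
    \<open>exp (t$k)\<close>, so the circle lies on the torus where \<phi> is monotone.\<close>
  define b :: "complex^'n" where "b = (\<chi> k. if \<zeta>$k = 0 then of_real (exp (t$k)) else 0)"
  have "u (\<zeta> + (of_real 1 * exp (\<i> * of_real \<theta>)) *s b) \<le> ereal (\<phi> t)" for \<theta>
  proof -
    let ?w = "\<zeta> + (of_real 1 * exp (\<i> * of_real \<theta>)) *s b"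
    have w: "?w $ k \<noteq> 0" "cmod (?w $ k) \<le> exp (t$k)" for k
      using assms[of k] by (auto simp: b_def norm_mult)
    have "u ?w = ereal (\<phi> (logmod ?w))" using w by (intro u_torus) blast
    moreover have "\<phi> (logmod ?w) \<le> \<phi> t"
    proof (rule phi_mono)
      fix k
      have "ln (cmod (?w $ k)) \<le> ln (exp (t$k))" using w[of k] by (intro ln_mono) auto
      then show "logmod ?w $ k \<le> t$k" by (simp add: logmod_def)
    qed
    ultimately show ?thesis by simp
  qed
  then have "circle_mean u \<zeta> b 1 \<le> ereal (integral {0..2*pi} (\<lambda>_. \<phi> t) / (2*pi))"
    by (intro circle_mean_le) auto
  then have "circle_mean u \<zeta> b 1 \<le> ereal (\<phi> t)" by simp
  then show ?thesis using u_le_circle_mean[of 1 \<zeta> b] order_trans by auto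
qed

text \<open>The supremum over the polydisc is attained at
  \<open>expvec (R *\<^sub>R logmod z)\<close>, so the quotient defining \<open>Psi0\<close> is
  \<open>\<phi> (R *\<^sub>R logmod z) / R\<close>.\<close>

lemma Psi_torus:
  assumes nz: "\<forall>k. z$k \<noteq> 0"
  shows "Psi u z = ereal (recession \<phi> (logmod z))"
proof -
  have Sup_eq: "Sup {u \<zeta> | \<zeta>. \<forall>k. norm (\<zeta>$k) \<le> norm (z$k) powr R} = ereal (\<phi> (R *\<^sub>R logmod z))" for R
  proof -
    have pw: "norm (z$k) powr R = exp ((R *\<^sub>R logmod z) $ k)" for k
      using nz by (simp add: powr_def logmod_def)
    show ?thesis
    proof (rule antisym)
      show "Sup {u \<zeta> | \<zeta>. \<forall>k. norm (\<zeta>$k) \<le> norm (z$k) powr R} \<le> ereal (\<phi> (R *\<^sub>R logmod z))"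
        unfolding pw by (rule Sup_least) (auto intro: u_le_phi)
      have "u (expvec (R *\<^sub>R logmod z)) \<le> Sup {u \<zeta> | \<zeta>. \<forall>k. norm (\<zeta>$k) \<le> norm (z$k) powr R}"
        unfolding pw by (rule Sup_upper) (auto simp: expvec_def intro!: exI[of _ "expvec (R *\<^sub>R logmod z)"])
      then show "ereal (\<phi> (R *\<^sub>R logmod z)) \<le> Sup {u \<zeta> | \<zeta>. \<forall>k. norm (\<zeta>$k) \<le> norm (z$k) powr R}"
        by (simp add: u_expvec)
    qed
  qed
  have "((\<lambda>R. ereal (\<phi> (R *\<^sub>R logmod z) / R)) \<longlongrightarrow> ereal (recession \<phi> (logmod z))) at_top"
    using recession_tendsto by simp
  moreover have "\<forall>\<^sub>F R in at_top. ereal (\<phi> (R *\<^sub>R logmod z) / R)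
      = Sup {u \<zeta> | \<zeta>. \<forall>k. norm (\<zeta>$k) \<le> norm (z$k) powr R} / ereal R"
    using eventually_gt_at_top[of 0] by eventually_elim (simp add: Sup_eq)
  ultimately have "((\<lambda>R. Sup {u \<zeta> | \<zeta>. \<forall>k. norm (\<zeta>$k) \<le> norm (z$k) powr R} / ereal R)
      \<longlongrightarrow> ereal (recession \<phi> (logmod z))) at_top"
    by (rule Lim_transform_eventually)
  then have "Psi0 u z = ereal (recession \<phi> (logmod z))"
    unfolding Psi0_def by (intro tendsto_Lim) auto
  then show ?thesis using nz by (simp add: Psi_def)
qed

lemma Gamma_inf_eq: "Gamma_inf u = {a. \<forall>t. a \<bullet> t \<le> max (recession \<phi> t) 0}"
proof -
  have "psi u t = ereal (recession \<phi> t)" for t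
  proof -
    have "\<forall>k. expvec t $ k \<noteq> 0" by (simp add: expvec_def)
    then show ?thesis using Psi_torus[of "expvec t"] by (simp add: psi_def flip: expvec_def)
  qed
  moreover have "ereal y \<le> max (ereal x) 0 \<longleftrightarrow> y \<le> max x 0" for x y by (simp add: le_max_iff_disj)
  ultimately show ?thesis by (simp add: Gamma_inf_def)
qed

end

theorem theorem8p5:
  fixes u :: "complex^'n \<Rightarrow> ereal"
  assumes "LPSH_star u" and "toric u" and "c_inf u < 1"
  shows "P_inf u = P_inf (Psi u)
    \<and> P_inf u = monom_span {J. (\<chi> k. real (J$k) + 1) \<in> interior (Gamma_inf u)}"
proof -
  interpret toric_LPSH_star u using assms by unfold_locales
  \<comment> \<open>Both instances have \<open>recession \<phi>\<close> as second component, so the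
    same exponents result for \<open>u\<close> and for \<open>Psi u\<close>.\<close>
  note weight = toric_weight_recession and weight_self = toric_weight_recession_self
  have "P_inf u = monom_span {J. (\<chi> k. real (J$k) + 1) \<in> interior (Gamma_inf u)}"
    using toric_weight.P_inf_eq_monom_span[OF weight, of u] u_torus
    by (simp add: Gamma_inf_eq toric_weight.interior_support_set[OF weight])
  moreover have "P_inf (Psi u) = monom_span {J. (\<chi> k. real (J$k) + 1) \<in> interior (Gamma_inf u)}"
    using toric_weight.P_inf_eq_monom_span[OF weight_self, of "Psi u"] Psi_torus
    by (simp add: Gamma_inf_eq toric_weight.interior_support_set[OF weight])
  ultimately show ?thesis by simp
qed

end
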